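(* Let $\{x^t\}_{t\ge 0}$ be the sequence of iterates generated by the IQN method applied to $f=\frac1n\sum_{i=1}^n f_i$, where the $f_i$ satisfy the following two assumptions. (1) There are constants $0<\mu\le L$ with $\mu\|x-\hat x\|^2\le(\nabla f_i(x)-\nabla f_i(\hat x))^T(x-\hat x)\le L\|x-\hat x\|^2$ for all $i$ and all $x,\hat x\in\mathbb{R}^p$. (2) There is a constant $\tilde L>0$ with $\|\nabla^2 f_i(x)-\nabla^2 f_i(\hat x)\|\le\tilde L\|x-\hat x\|$ for all $i$ and all $x,\hat x\in\mathbb{R}^p$. Let $r\in(0,1)$ and let $(\epsilon(r),\delta(r))$ be an $r$-admissible pair (defined in the context). Suppose that $\|x^0-x^*\|<\epsilon(r)$, that $\|B_i^0-\nabla^2 f_i(x^* )\|_{M_i}<\delta(r)$ for $i=1,\dots,n$, where $M_i=\nabla^2 f_i(x^* )^{-1/2}$, and that for every $t\ge0$, with $i=i_t$, the quantity $\sigma_i^t:=\max\{\|z_i^{t+1}-x^*\|,\|z_i^t-x^*\|\}$ satisfies $\sigma_i^t<\mu/(3\tilde L)$. Then $$\lim_{t\to\infty}\frac{\|x^t-x^*\|}{\frac1n\left(\|x^{t-1}-x^*\|+\dots+\|x^{t-n}-x^*\|\right)}=0.$$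
   Context: Let $f_1,\dots,f_n:\mathbb{R}^p\to\mathbb{R}$ be twice differentiable, $f=\frac1n\sum_{i=1}^n f_i$, and let $x^*$ be the unique minimizer of $f$ over $\mathbb{R}^p$. $\|\cdot\|$ is the Euclidean norm for vectors and the induced norm for matrices. For a positive definite matrix $M$, $\|A\|_M:=\|MAM\|_F$, with $\|\cdot\|_F$ the Frobenius norm. IQN method. Inputs: $x^0\in\mathbb{R}^p$ and symmetric positive definite matrices $B_1^0,\dots,B_n^0\in\mathbb{R}^{p\times p}$. Set $z_1^0=\dots=z_n^0=x^0$. For $t=0,1,2,\dots$: - let $i_t=(t \bmod n)+1$; - set $x^{t+1}=\left(\frac1n\sum_{i=1}^n B_i^t\right)^{-1}\left[\frac1n\sum_{i=1}^n B_i^t z_i^t-\frac1n\sum_{i=1}^n\nabla f_i(z_i^t)\right]$; - set $z_{i_t}^{t+1}=x^{t+1}$ and $z_i^{t+1}=z_i^t$ for $i\ne i_t$; - with $s_i^t=z_i^{t+1}-z_i^t$ and $y_i^t=\nabla f_i(z_i^{t+1})-\nabla f_i(z_i^t)$, set for $i=i_t$ $$B_i^{t+1}=B_i^t+\frac{y_i^t (y_i^t)^T}{(y_i^t)^T s_i^t}-\frac{B_i^t s_i^t (s_i^t)^T B_i^t}{(s_i^t)^T B_i^t s_i^t},$$ and $B_i^{t+1}=B_i^t$ for $i\neq i_t$. It is understood that $s_{i_t}^t\ne0$ for all $t$, so that the updates are well defined. $r$-admissible pair: for fixed $f_1,\dots,f_n$ and $r\in(0,1)$, a pair of positive constants $(\epsilon(r),\delta(r))$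 is called $r$-admissible if, for every initialization with $\|x^0-x^*\|<\epsilon(r)$ and $\|B_i^0-\nabla^2 f_i(x^* )\|_{M_i}<\delta(r)$, $M_i=\nabla^2 f_i(x^* )^{-1/2}$, $i=1,\dots,n$, the IQN iterates satisfy $\|x^t-x^*\|\le r^{\lfloor (t-1)/n\rfloor+1}\|x^0-x^*\|$ for all $t$, and the sequences $\{\|B_i^t\|\}$ and $\{\|(B_i^t)^{-1}\|\}$ are uniformly bounded. *)

theory Defs
  imports "HOL-Analysis.Analysis"
begin

definition grad :: "('a::real_inner \<Rightarrow> real) \<Rightarrow> 'a \<Rightarrow> 'a"
  where "grad f x = (THE D. GDERIV f x :> D)"

definition hess :: "(real^'p \<Rightarrow> real) \<Rightarrow> real^'p \<Rightarrow> real^'p^'p"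
  where "hess f x = jacobian (grad f) (at x)"

definition twice_differentiable :: "(real^'p \<Rightarrow> real) \<Rightarrow> bool"
  where "twice_differentiable f \<longleftrightarrow>
    (\<forall>x. f differentiable (at x)) \<and> (\<forall>x. grad f differentiable (at x))"

definition unique_minimizer :: "('a \<Rightarrow> real) \<Rightarrow> 'a \<Rightarrow> bool"
  where "unique_minimizer F xs \<longleftrightarrow>
    is_arg_min F (\<lambda>_. True) xs \<and> (\<forall>y. is_arg_min F (\<lambda>_. True) y \<longrightarrow> y = xs)"

abbreviation opnorm :: "real^'p^'p \<Rightarrow> real"
  where "opnorm A \<equiv> onorm ((*v) A)"

definition spd :: "real^'p^'p \<Rightarrow> bool"
  where "spd A \<longleftrightarrow> transpose A = A \<and> (\<forall>v. v \<noteq> 0 \<longrightarrow> 0 < v \<bullet> (A *v v))"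

text \<open>The square root of a symmetric positive definite matrix is its unique symmetric positive
  definite root; \<open>inv_sqrt A\<close> is the matrix usually written with exponent \<open>-1/2\<close>. It is meaningful
  only for symmetric positive definite \<open>A\<close>.\<close>

definition spd_sqrt :: "real^'p^'p \<Rightarrow> real^'p^'p"
  where "spd_sqrt A = (THE S. spd S \<and> S ** S = A)"

definition inv_sqrt :: "real^'p^'p \<Rightarrow> real^'p^'p"
  where "inv_sqrt A = matrix_inv (spd_sqrt A)"

definition frobenius_norm :: "real^'p^'p \<Rightarrow> real"
  where "frobenius_norm A = sqrt (\<Sum>i\<in>UNIV. \<Sum>j\<in>UNIV. (A $ i $ j)\<^sup>2)"

lemma frobenius_norm_eq_norm: "frobenius_norm A = norm A"
  by (simp add: frobenius_norm_def norm_vec_def L2_set_def sum_nonneg)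

definition weighted_norm :: "real^'p^'p \<Rightarrow> real^'p^'p \<Rightarrow> real"
  where "weighted_norm M A = frobenius_norm (M ** A ** M)"

definition outer :: "real^'p \<Rightarrow> real^'p \<Rightarrow> real^'p^'p"
  where "outer u v = (\<chi> i j. u $ i * v $ j)"

definition bfgs_update :: "real^'p^'p \<Rightarrow> real^'p \<Rightarrow> real^'p \<Rightarrow> real^'p^'p"
  where "bfgs_update B s y =
    B + (1 / (y \<bullet> s)) *\<^sub>R outer y y
      - (1 / (s \<bullet> (B *v s))) *\<^sub>R (B ** outer s s ** B)"

definition iqn_index :: "nat \<Rightarrow> nat \<Rightarrow> nat"
  where "iqn_index n t = t mod n + 1"

text \<open>\<open>iqn_run n f x z B\<close>: the sequences \<open>x\<^sup>t = x t\<close>, \<open>z\<^sub>i\<^sup>t = z i t\<close>, \<open>B\<^sub>i\<^sup>t = B i t\<close>, for \<open>i \<in> {1..n}\<close>, are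
  generated by the IQN method on \<open>f\<^sub>1, \<dots>, f\<^sub>n\<close>, started at \<open>x 0\<close> and \<open>B i 0\<close>. That the
  updates are well defined, i.e. that the steps \<open>s\<close> do not vanish, is part of being a run.\<close>

definition iqn_run ::
  "nat \<Rightarrow> (nat \<Rightarrow> real^'p \<Rightarrow> real) \<Rightarrow> (nat \<Rightarrow> real^'p) \<Rightarrow> (nat \<Rightarrow> nat \<Rightarrow> real^'p)
    \<Rightarrow> (nat \<Rightarrow> nat \<Rightarrow> real^'p^'p) \<Rightarrow> bool"
  where "iqn_run n f x z B \<longleftrightarrow>
    (\<forall>i\<in>{1..n}. z i 0 = x 0 \<and> spd (B i 0)) \<and>
    (\<forall>t. x (Suc t) =
        matrix_inv ((1 / real n) *\<^sub>R (\<Sum>i=1..n. B i t)) *v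
          ((1 / real n) *\<^sub>R (\<Sum>i=1..n. B i t *v z i t)
            - (1 / real n) *\<^sub>R (\<Sum>i=1..n. grad (f i) (z i t)))) \<and>
    (\<forall>t. \<forall>i\<in>{1..n}.
        if i = iqn_index n t then
          (let s = z i (Suc t) - z i t;
               y = grad (f i) (z i (Suc t)) - grad (f i) (z i t)
           in z i (Suc t) = x (Suc t) \<and> s \<noteq> 0 \<and> B i (Suc t) = bfgs_update (B i t) s y)
        else z i (Suc t) = z i t \<and> B i (Suc t) = B i t)"

definition iqn_close_start ::
  "nat \<Rightarrow> (nat \<Rightarrow> real^'p \<Rightarrow> real) \<Rightarrow> real^'p \<Rightarrow> real \<Rightarrow> real \<Rightarrow> real^'p \<Rightarrow> (nat \<Rightarrow> real^'p^'p) \<Rightarrow> bool"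
  where "iqn_close_start n f xs \<epsilon> \<delta> x0 B0 \<longleftrightarrow>
    norm (x0 - xs) < \<epsilon> \<and>
    (\<forall>i\<in>{1..n}. weighted_norm (inv_sqrt (hess (f i) xs)) (B0 i - hess (f i) xs) < \<delta>)"

text \<open>For \<open>t = 0\<close> the floor is \<open>-1\<close>, hence the integer power \<open>powi\<close>; the exponent is never
  negative. The bound \<open>C\<close> may depend on the run, but not on \<open>i\<close> or \<open>t\<close>.\<close>

definition admissible_pair ::
  "nat \<Rightarrow> (nat \<Rightarrow> real^'p \<Rightarrow> real) \<Rightarrow> real^'p \<Rightarrow> real \<Rightarrow> real \<Rightarrow> real \<Rightarrow> bool"
  where "admissible_pair n f xs r \<epsilon> \<delta> \<longleftrightarrow>
    0 < \<epsilon> \<and> 0 < \<delta> \<and>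
    (\<forall>x z B. iqn_run n f x z B \<and> iqn_close_start n f xs \<epsilon> \<delta> (x 0) (\<lambda>i. B i 0) \<longrightarrow>
      (\<forall>t. norm (x t - xs) \<le> r powi (\<lfloor>(real t - 1) / real n\<rfloor> + 1) * norm (x 0 - xs)) \<and>
      (\<exists>C. \<forall>i\<in>{1..n}. \<forall>t. opnorm (B i t) \<le> C \<and> opnorm (matrix_inv (B i t)) \<le> C))"

end

theory Submission
  imports Defs "HOL-Library.Landau_Symbols"
begin

text \<open>
  Write \<open>K\<close> for the inverse of \<open>B\<^sub>i\<^sup>t\<close> and \<open>w = K y - s\<close>. If \<open>G\<close> is symmetric positive definite with
  \<open>G s = y\<close>, a BFGS update decreases the \<open>G\<close>-weighted squared Frobenius distance from \<open>K\<close> to the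
  inverse of \<open>G\<close> by at least \<open>(w \<bullet> G w) / (y \<bullet> s)\<close>. Such a \<open>G\<close> exists within \<open>O(\<sigma>\<^sub>i\<^sup>t)\<close> of the
  Hessian \<open>H\<^sub>i\<close> of \<open>f\<^sub>i\<close> at \<open>x\<^sup>*\<close>, and \<open>\<sigma>\<^sub>i\<^sup>t\<close> is summable because the iterates converge linearly. As
  the matrices are bounded, the decreases are summable: \<open>\<parallel>w\<parallel> / \<parallel>s\<parallel>\<close> tends to 0, hence
  \<open>(B\<^sub>i\<^sup>t - H\<^sub>i) s = o(\<parallel>s\<parallel>)\<close>, and the change of \<open>B\<^sub>i\<^sup>t\<close> in an update tends to 0.

  Let \<open>e\<^sup>t = x\<^sup>t - x\<^sup>*\<close>, let \<open>W\<^sub>t\<close> be the sum of the last \<open>n\<close> error norms, and let \<open>g\<^sub>t\<close> be the sum over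
  \<open>i\<close> of \<open>(B\<^sub>i\<^sup>t - H\<^sub>i)(z\<^sub>i\<^sup>t - x\<^sup>*)\<close>. The IQN step says \<open>(\<Sum>\<^sub>i B\<^sub>i\<^sup>t) e\<^bsup>t+1\<^esup> = g\<^sub>t + o(W\<^sub>t)\<close>, and by
  the above \<open>g\<close> changes only by \<open>o(W\<^sub>t)\<close> over a cycle. So \<open>e\<^bsup>t+1\<^esup>, \<dots>, e\<^bsup>t+n\<^esup>\<close> agree up to
  \<open>o(W\<^sub>t)\<close>; after the cycle they are all the \<open>z\<^sub>i - x\<^sup>*\<close>, which gives
  \<open>g\<^sub>t = (\<Sum>\<^sub>i (B\<^sub>i\<^sup>t - H\<^sub>i)) e\<^bsup>t+1\<^esup> + o(W\<^sub>t)\<close>. Comparing the two formulas, \<open>(\<Sum>\<^sub>i H\<^sub>i) e\<^bsup>t+1\<^esup> = o(W\<^sub>t)\<close>.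
\<close>

section \<open>Matrix norms and positive definite matrices\<close>

lemma inner_matrix_vector_sym:
  fixes A :: "real^'p^'p"
  assumes "transpose A = A"
  shows "(A *v u) \<bullet> v = u \<bullet> (A *v v)"
  by (metis assms dot_lmul_matrix vector_transpose_matrix)

lemma symmetric_matrixI:
  fixes A :: "real^'p^'p"
  assumes "\<And>u v. (A *v u) \<bullet> v = u \<bullet> (A *v v)"
  shows "transpose A = A"
proof -
  have "transpose A *v v = A *v v" for v
    by (rule vector_eq_rdot[THEN iffD1]) (metis assms dot_lmul_matrix inner_commute transpose_matrix_vector)
  then show ?thesis by (simp add: matrix_eq)
qed

text \<open>\<open>norm\<close> of a matrix is the Frobenius norm, so Cauchy-Schwarz applies row by
  row.\<close>

lemma norm_matrix_vector_mult_le: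
  fixes A :: "real^'n^'m"
  shows "norm (A *v x) \<le> norm A * norm x"
proof -
  have "norm (A *v x) = L2_set (\<lambda>i. \<bar>A $ i \<bullet> x\<bar>) UNIV"
    by (simp add: norm_vec_def matrix_vector_mul_component)
  also have "\<dots> \<le> L2_set (\<lambda>i. norm (A $ i) * norm x) UNIV"
    by (intro L2_set_mono) (auto simp: Cauchy_Schwarz_ineq2)
  also have "\<dots> = norm A * norm x"
    by (simp add: L2_set_left_distrib norm_vec_def)
  finally show ?thesis .
qed

lemma norm_transpose:
  fixes A :: "real^'n^'m"
  shows "norm (transpose A) = norm A"
  unfolding norm_vec_def transpose_def L2_set_def
  by (simp add: sum_nonneg) (rule sum.swap)

lemma norm_matrix_mult_le:
  fixes A :: "real^'n^'m" and B :: "real^'k^'n"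
  shows "norm (A ** B) \<le> norm A * norm B"
proof -
  have row: "(A ** B) $ i = transpose B *v (A $ i)" for i
    by (simp add: vec_eq_iff matrix_matrix_mult_def matrix_vector_mult_def transpose_def mult.commute)
  have "norm (A ** B) = L2_set (\<lambda>i. norm (transpose B *v (A $ i))) UNIV"
    by (simp only: norm_vec_def row)
  also have "\<dots> \<le> L2_set (\<lambda>i. norm (A $ i) * norm B) UNIV"
    by (intro L2_set_mono) (metis norm_matrix_vector_mult_le norm_transpose mult.commute, simp)
  also have "\<dots> = norm A * norm B"
    by (simp add: L2_set_left_distrib norm_vec_def)
  finally show ?thesis .
qed

text \<open>Admissibility bounds operator norms, while the estimates below use Frobenius norms. Each
  entry is at most the operator norm; the crude factor is harmless because only boundedness
  matters.\<close>

lemma norm_le_opnorm: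
  fixes A :: "real^'p^'p"
  shows "norm A \<le> (real CARD('p))\<^sup>2 * opnorm A"
proof -
  have "norm A \<le> (\<Sum>i\<in>UNIV. norm (A $ i))"
    unfolding norm_vec_def by (intro L2_set_le_sum) simp
  also have "\<dots> \<le> (\<Sum>i\<in>UNIV. \<Sum>j\<in>UNIV. \<bar>A $ i $ j\<bar>)"
    by (intro sum_mono norm_le_l1_cart)
  also have "\<dots> \<le> (\<Sum>(i::'p)\<in>UNIV. \<Sum>(j::'p)\<in>UNIV. opnorm A)"
    by (intro sum_mono matrix_component_le_onorm)
  finally show ?thesis by (simp add: power2_eq_square mult.assoc)
qed

section \<open>Rank-one matrices\<close>

lemma outer_mult_vec: "outer u v *v x = (v \<bullet> x) *\<^sub>R u"
  by (simp add: outer_def vec_eq_iff matrix_vector_mult_def inner_vec_def sum_distrib_left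
      sum_distrib_right mult_ac)

text \<open>Against rank-one matrices the Frobenius inner product becomes a bilinear form in
  vectors, which is how the BFGS potential is computed.\<close>

lemma inner_outer: "A \<bullet> outer u v = u \<bullet> (A *v v)"
  by (simp add: outer_def matrix_vector_mult_def inner_vec_def sum_distrib_left mult_ac)

lemma norm_outer: "norm (outer u v) = norm u * norm v"
proof -
  have "norm (outer u v) ^ 2 = (norm u * norm v) ^ 2"
    unfolding power_mult_distrib power2_norm_eq_inner inner_outer outer_mult_vec by simp
  then show ?thesis by (simp add: power2_eq_iff_nonneg)
qed

section \<open>Symmetric positive definite matrices and their inverses\<close>

lemma spd_invertible:
  assumes "spd A" shows "invertible A"
proof -
  have "x = 0" if "A *v x = 0" for x
    using assms that unfolding spd_def by (metis inner_zero_right less_irrefl)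
  then show ?thesis
    unfolding invertible_left_inverse matrix_left_invertible_ker by blast
qed

lemma matrix_inv_inverse:
  assumes "invertible A"
  shows "A ** matrix_inv A = mat 1" "matrix_inv A ** A = mat 1"
  using someI_ex[OF assms[unfolded invertible_def]] by (simp_all add: matrix_inv_def)

lemma matrix_inv_vec:
  fixes A :: "real^'p^'p"
  assumes "invertible A"
  shows "A *v (matrix_inv A *v v) = v" "matrix_inv A *v (A *v v) = v"
  using assms by (simp_all add: matrix_vector_mul_assoc matrix_inv_inverse)

text \<open>Writing \<open>u\<close> as \<open>A *v (X *v u)\<close> carries symmetry and positivity
  over from \<open>A\<close> to \<open>X\<close>.\<close>

lemma spd_right_inverse:
  fixes A X :: "real^'p^'p"
  assumes "spd A" "A ** X = mat 1"
  shows "spd X"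
proof -
  have sym: "transpose A = A" using assms(1) by (simp add: spd_def)
  have AX: "A *v (X *v v) = v" for v using assms(2) by (simp add: matrix_vector_mul_assoc)
  have "(X *v u) \<bullet> v = u \<bullet> (X *v v)" for u v
    by (metis AX inner_matrix_vector_sym[OF sym])
  moreover have "0 < v \<bullet> (X *v v)" if "v \<noteq> 0" for v
  proof -
    have "X *v v \<noteq> 0" using AX[of v] that by auto
    then have "0 < (X *v v) \<bullet> (A *v (X *v v))" using assms(1) by (simp add: spd_def)
    then show ?thesis by (simp add: AX inner_commute)
  qed
  ultimately show ?thesis unfolding spd_def by (blast intro: symmetric_matrixI)
qed

lemma spd_matrix_inv:
  assumes "spd A" shows "spd (matrix_inv A)"
  using assms matrix_inv_inverse(1) spd_invertible spd_right_inverse by blast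

lemma spd_nonneg:
  assumes "spd A" shows "0 \<le> v \<bullet> (A *v v)"
  using assms unfolding spd_def by (cases "v = 0") (auto intro: less_imp_le)

text \<open>The form is nonnegative at \<open>v\<close> minus its \<open>A\<close>-orthogonal
  projection onto \<open>u\<close>; that vector is \<open>?x\<close> below.\<close>

lemma spd_Cauchy_Schwarz:
  assumes A: "spd A"
  shows "(u \<bullet> (A *v v))\<^sup>2 \<le> (u \<bullet> (A *v u)) * (v \<bullet> (A *v v))"
proof (cases "u = 0")
  case False
  define a where "a = u \<bullet> (A *v u)"
  define b where "b = u \<bullet> (A *v v)"
  have "a > 0" using A False by (simp add: spd_def a_def)
  have b': "v \<bullet> (A *v u) = b"
    using A by (metis b_def inner_commute inner_matrix_vector_sym spd_def)
  let ?x = "v - (b/a) *\<^sub>R u"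
  have "0 \<le> ?x \<bullet> (A *v ?x)" using spd_nonneg[OF A] .
  also have "\<dots> = v \<bullet> (A *v v) - 2 * (b/a) * b + (b/a)\<^sup>2 * a"
    by (simp add: matrix_vector_mult_diff_distrib matrix_vector_mult_scaleR inner_diff_left
        inner_diff_right b' power2_eq_square flip: a_def b_def)
  also have "\<dots> = v \<bullet> (A *v v) - b\<^sup>2 / a"
    using \<open>a > 0\<close> by (simp add: field_simps power2_eq_square)
  finally show ?thesis using \<open>a > 0\<close> by (simp add: field_simps flip: a_def b_def)
qed simp

text \<open>Cauchy-Schwarz for the form of the inverse is applied to \<open>v\<close> and
  \<open>B *v v\<close>. A bound on the inverse thus becomes a lower bound on the form of
  \<open>B\<close>; such bounds add up over the components, unlike bounds on inverses.\<close>

lemma spd_coercive: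
  assumes B: "spd B" and C: "norm (matrix_inv B) \<le> C"
  shows "(norm v)\<^sup>2 \<le> C * (v \<bullet> (B *v v))"
proof (cases "v = 0")
  case False
  let ?K = "matrix_inv B"
  have inv: "?K *v (B *v v) = v" by (simp add: B matrix_inv_vec(2) spd_invertible)
  have "(v \<bullet> v)\<^sup>2 \<le> (v \<bullet> (?K *v v)) * ((B *v v) \<bullet> v)"
    using spd_Cauchy_Schwarz[OF spd_matrix_inv[OF B], of v "B *v v"] by (simp add: inv)
  also have "\<dots> \<le> (C * (v \<bullet> v)) * ((B *v v) \<bullet> v)"
  proof (rule mult_right_mono)
    have "v \<bullet> (?K *v v) \<le> norm v * (norm ?K * norm v)"
      by (meson norm_cauchy_schwarz norm_matrix_vector_mult_le mult_left_mono norm_ge_zero order_trans)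
    also have "\<dots> \<le> norm v * (C * norm v)"
      by (intro mult_left_mono mult_right_mono C) auto
    finally show "v \<bullet> (?K *v v) \<le> C * (v \<bullet> v)"
      by (simp add: dot_square_norm power2_eq_square mult_ac)
    show "0 \<le> (B *v v) \<bullet> v" using spd_nonneg[OF B, of v] by (simp add: inner_commute)
  qed
  finally have "(v \<bullet> v) * (v \<bullet> v) \<le> (v \<bullet> v) * (C * (v \<bullet> (B *v v)))"
    by (simp add: power2_eq_square mult_ac inner_commute)
  then have "v \<bullet> v \<le> C * (v \<bullet> (B *v v))"
    using False mult_le_cancel_left_pos[of "v \<bullet> v"] by simp
  then show ?thesis by (simp add: power2_norm_eq_inner)
qed simp

section \<open>The inverse BFGS update and its potential\<close>

text \<open>The BFGS update in inverse form, for symmetric \<open>K\<close> equal to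
  \<open>(I - \<rho> s y^T) K (I - \<rho> y s^T) + \<rho> s s^T\<close>. Expanded in
  \<open>w\<close>, the failure of the secant equation, the correction is linear in
  \<open>w\<close>.\<close>

definition inv_bfgs :: "real^'p^'p \<Rightarrow> real^'p \<Rightarrow> real^'p \<Rightarrow> real^'p^'p" where
  "inv_bfgs K s y = (let w = K *v y - s; \<rho> = 1 / (y \<bullet> s) in
     K - \<rho> *\<^sub>R (outer s w + outer w s) + (\<rho>\<^sup>2 * (y \<bullet> w)) *\<^sub>R outer s s)"

text \<open>This is the product form of the update: \<open>v'\<close> is the right factor
  \<open>I - \<rho> y s^T\<close> applied to \<open>v\<close>, and it is orthogonal to
  \<open>s\<close>.\<close>

lemma inv_bfgs_vec:
  fixes K :: "real^'p^'p" and s y v :: "real^'p"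
  assumes K: "transpose K = K" and ys: "y \<bullet> s \<noteq> 0"
  defines "\<rho> \<equiv> 1 / (y \<bullet> s)"
  defines "v' \<equiv> v - (\<rho> * (s \<bullet> v)) *\<^sub>R y"
  shows "inv_bfgs K s y *v v = K *v v' + (\<rho> * (s \<bullet> v - y \<bullet> (K *v v'))) *\<^sub>R s"
proof -
  define w where "w = K *v y - s"
  have sv': "s \<bullet> v' = 0" using ys by (simp add: v'_def \<rho>_def inner_diff_right inner_commute)
  have "y \<bullet> (K *v v') = (K *v y) \<bullet> v'" by (simp add: inner_matrix_vector_sym[OF K])
  also have "\<dots> = w \<bullet> v'" using sv' by (simp add: w_def inner_diff_left)
  also have "\<dots> = w \<bullet> v - \<rho> * (s \<bullet> v) * (w \<bullet> y)" by (simp add: v'_def inner_diff_right)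
  finally have y: "y \<bullet> (K *v v') = w \<bullet> v - \<rho> * (s \<bullet> v) * (w \<bullet> y)" .
  have Kv': "K *v v' = K *v v - (\<rho> * (s \<bullet> v)) *\<^sub>R (w + s)"
    by (simp add: v'_def w_def matrix_vector_mult_diff_distrib matrix_vector_mult_scaleR)
  have "inv_bfgs K s y *v v
      = K *v v - \<rho> *\<^sub>R ((w \<bullet> v) *\<^sub>R s + (s \<bullet> v) *\<^sub>R w) + (\<rho>\<^sup>2 * (y \<bullet> w)) *\<^sub>R (s \<bullet> v) *\<^sub>R s"
    unfolding inv_bfgs_def Let_def w_def[symmetric] \<rho>_def[symmetric]
    by (simp add: matrix_vector_mult_add_rdistrib matrix_vector_mult_diff_rdistrib outer_mult_vec
        flip: scaleR_matrix_vector_assoc)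
  then show ?thesis unfolding y unfolding Kv'
    by (simp add: algebra_simps power2_eq_square inner_commute)
qed

text \<open>As \<open>v'\<close> is orthogonal to \<open>s\<close>, the subtracted rank-one term
  removes exactly the part \<open>\<beta> *\<^sub>R (B *v s)\<close> of \<open>B *v u\<close>; as
  \<open>y \<bullet> u = s \<bullet> v\<close>, the added term restores the multiple of
  \<open>y\<close> that separates \<open>v'\<close> from \<open>v\<close>.\<close>

lemma bfgs_update_inverse:
  fixes B :: "real^'p^'p"
  assumes B: "spd B" and ys: "0 < y \<bullet> s"
  shows "bfgs_update B s y ** inv_bfgs (matrix_inv B) s y = mat 1"
proof -
  define K where "K = matrix_inv B"
  define \<rho> where "\<rho> = 1 / (y \<bullet> s)"
  have symB: "transpose B = B" using B by (simp add: spd_def)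
  have K: "spd K" unfolding K_def using spd_matrix_inv[OF B] .
  have BK: "B *v (K *v v) = v" for v by (simp add: B K_def matrix_inv_vec spd_invertible)
  have "s \<noteq> 0" using ys by auto
  then have sBs: "s \<bullet> (B *v s) > 0" using B by (simp add: spd_def)
  have "bfgs_update B s y *v (inv_bfgs K s y *v v) = v" for v
  proof -
    define v' where "v' = v - (\<rho> * (s \<bullet> v)) *\<^sub>R y"
    define \<beta> where "\<beta> = \<rho> * (s \<bullet> v - y \<bullet> (K *v v'))"
    define u where "u = K *v v' + \<beta> *\<^sub>R s"
    have u: "inv_bfgs K s y *v v = u"
      unfolding u_def \<beta>_def v'_def \<rho>_def
      by (rule inv_bfgs_vec) (use K ys in \<open>auto simp: spd_def\<close>)
    have sv': "s \<bullet> v' = 0" using ys by (simp add: v'_def \<rho>_def inner_diff_right inner_commute)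
    have Bu: "B *v u = v' + \<beta> *\<^sub>R (B *v s)"
      by (simp add: u_def matrix_vector_right_distrib matrix_vector_mult_scaleR BK)
    have yu: "y \<bullet> u = s \<bullet> v" using ys by (simp add: u_def \<beta>_def \<rho>_def inner_add_right)
    have Bss: "(B ** outer s s ** B) *v u = (s \<bullet> (B *v u)) *\<^sub>R (B *v s)"
      by (simp add: outer_mult_vec matrix_vector_mult_scaleR flip: matrix_vector_mul_assoc)
    have "bfgs_update B s y *v u
       = B *v u + (\<rho> * (y \<bullet> u)) *\<^sub>R y - ((s \<bullet> (B *v u)) / (s \<bullet> (B *v s))) *\<^sub>R (B *v s)"
      unfolding bfgs_update_def
      by (simp add: matrix_vector_mult_add_rdistrib matrix_vector_mult_diff_rdistrib outer_mult_vec
          Bss \<rho>_def flip: scaleR_matrix_vector_assoc)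
    also have "\<dots> = v"
      using sBs sv' by (simp add: yu Bu inner_add_right v'_def)
    finally show ?thesis by (simp add: u)
  qed
  then show ?thesis by (simp add: matrix_eq K_def flip: matrix_vector_mul_assoc)
qed

text \<open>By the product form the value at \<open>v\<close> is the form of \<open>K\<close> at
  \<open>v'\<close> plus \<open>\<rho> * (s \<bullet> v)\<^sup>2\<close>. If
  \<open>s \<bullet> v\<close> vanishes then \<open>v' = v\<close>, so for nonzero \<open>v\<close>
  the two terms cannot vanish together.\<close>

lemma spd_inv_bfgs:
  fixes K :: "real^'p^'p"
  assumes K: "spd K" and ys: "0 < y \<bullet> s"
  shows "spd (inv_bfgs K s y)"
proof -
  have symK: "transpose K = K" using K by (simp add: spd_def)
  have "transpose (inv_bfgs K s y) = inv_bfgs K s y"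
  proof (rule symmetric_matrixI)
    fix u v
    show "(inv_bfgs K s y *v u) \<bullet> v = u \<bullet> (inv_bfgs K s y *v v)"
      by (simp add: inv_bfgs_def Let_def matrix_vector_mult_add_rdistrib
          matrix_vector_mult_diff_rdistrib outer_mult_vec inner_add_left inner_add_right
          inner_diff_left inner_diff_right inner_matrix_vector_sym[OF symK]
          flip: scaleR_matrix_vector_assoc)
        (use inner_matrix_vector_sym[OF symK, of y u] in \<open>simp add: inner_commute mult_ac\<close>)
  qed
  moreover have "0 < v \<bullet> (inv_bfgs K s y *v v)" if "v \<noteq> 0" for v
  proof -
    define \<rho> where "\<rho> = 1 / (y \<bullet> s)"
    define v' where "v' = v - (\<rho> * (s \<bullet> v)) *\<^sub>R y"
    have "v \<bullet> (inv_bfgs K s y *v v)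
      = v \<bullet> (K *v v' + (\<rho> * (s \<bullet> v - y \<bullet> (K *v v'))) *\<^sub>R s)"
      unfolding v'_def \<rho>_def by (subst inv_bfgs_vec) (use ys symK in auto)
    also have "\<dots> = v' \<bullet> (K *v v') + \<rho> * (s \<bullet> v)\<^sup>2"
      by (simp add: v'_def inner_add_right inner_diff_left algebra_simps power2_eq_square inner_commute)
    also have "\<dots> > 0"
    proof (cases "s \<bullet> v = 0")
      case True
      then show ?thesis using K that by (simp add: v'_def spd_def)
    next
      case False
      then show ?thesis using spd_nonneg[OF K, of v'] ys
        by (intro add_nonneg_pos) (auto simp: \<rho>_def)
    qed
    finally show ?thesis .
  qed
  ultimately show ?thesis by (simp add: spd_def)
qed

lemma bfgs_update_spd:
  fixes B :: "real^'p^'p"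
  assumes B: "spd B" and ys: "0 < y \<bullet> s"
  shows "spd (bfgs_update B s y)"
    and "matrix_inv (bfgs_update B s y) = inv_bfgs (matrix_inv B) s y"
proof -
  let ?A = "bfgs_update B s y" and ?X = "inv_bfgs (matrix_inv B) s y"
  have AX: "?A ** ?X = mat 1" using bfgs_update_inverse[OF B ys] .
  have XA: "?X ** ?A = mat 1" using AX matrix_left_right_inverse by blast
  show spd: "spd ?A"
    using spd_right_inverse[OF spd_inv_bfgs[OF spd_matrix_inv[OF B] ys] XA] .
  have "matrix_inv ?A = (?X ** ?A) ** matrix_inv ?A" by (simp add: XA)
  also have "\<dots> = ?X"
    by (simp add: matrix_inv_inverse(1)[OF spd_invertible[OF spd]] flip: matrix_mul_assoc)
  finally show "matrix_inv ?A = ?X" .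
qed

text \<open>For symmetric positive definite \<open>G\<close> and symmetric \<open>K\<close> this is, up to a constant,
  \<open>\<parallel>G\<^bsup>1/2\<^esup> (K - G\<^bsup>-1\<^esup>) G\<^bsup>1/2\<^esup>\<parallel>\<^sup>2\<close> in the Frobenius norm. It is the inverse of \<open>B\<close>, not \<open>B\<close>
  itself, whose distance to the secant matrix decreases under BFGS.\<close>

definition bfgs_potential :: "real^'p^'p \<Rightarrow> real^'p^'p \<Rightarrow> real" where
  "bfgs_potential G K = (G ** K ** G) \<bullet> K - 2 * (G \<bullet> K)"

text \<open>Expanding the quadratic potential at \<open>K + D\<close> leaves the change
  \<open>- 2 * \<rho> * a + \<rho>\<^sup>2 * b\<^sup>2\<close>. The secant equation
  \<open>G *v s = y\<close> makes all terms of the change expressible in \<open>a\<close>,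
  \<open>b\<close> and \<open>\<rho>\<close>.\<close>

lemma bfgs_potential_step:
  fixes K G :: "real^'p^'p"
  assumes K: "transpose K = K" and G: "spd G" and Gs: "G *v s = y" and ys: "0 < y \<bullet> s"
  defines "w \<equiv> K *v y - s"
  shows "bfgs_potential G (inv_bfgs K s y) \<le> bfgs_potential G K - (w \<bullet> (G *v w)) / (y \<bullet> s)"
proof -
  define \<rho> where "\<rho> = 1 / (y \<bullet> s)"
  define a where "a = w \<bullet> (G *v w)"
  define b where "b = y \<bullet> w"
  define D where "D = (- \<rho>) *\<^sub>R outer s w + (- \<rho>) *\<^sub>R outer w s + (\<rho>\<^sup>2 * b) *\<^sub>R outer s s"
  define F where "F X Y = (G ** X ** G) \<bullet> Y" for X Y :: "real^'p^'p"
  have symG: "transpose G = G" using G by (simp add: spd_def)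
  have FF: "(G ** X ** G) \<bullet> outer u v = (G *v u) \<bullet> (X *v (G *v v))" for X u v
    by (simp add: inner_outer inner_matrix_vector_sym[OF symG] flip: matrix_vector_mul_assoc)
  have addL: "F (X + Y) Z = F X Z + F Y Z" for X Y Z
    
  proof -
    have "G ** (X + Y) ** G = G ** X ** G + G ** Y ** G"
      by (simp add: matrix_eq matrix_vector_mult_add_rdistrib matrix_vector_right_distrib
          flip: matrix_vector_mul_assoc)
    then show ?thesis by (simp add: F_def inner_add_left)
  qed
  have addR: "F X (Y + Z) = F X Y + F X Z" for X Y Z by (simp add: F_def inner_add_right)
  have scL: "F (c *\<^sub>R X) Y = c * F X Y" for c X Y
    
  proof -
    have "G ** (c *\<^sub>R X) ** G = c *\<^sub>R (G ** X ** G)"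
      by (simp add: matrix_eq matrix_vector_mult_scaleR flip: matrix_vector_mul_assoc scaleR_matrix_vector_assoc)
    then show ?thesis by (simp add: F_def)
  qed
  have scR: "F X (c *\<^sub>R Y) = c * F X Y" for c X Y by (simp add: F_def)
  have diffL: "F (X - Y) Z = F X Z - F Y Z" for X Y Z
    using addL[of X "(-1) *\<^sub>R Y" Z] scL[of "-1" Y Z] by simp
  have diffR: "F X (Y - Z) = F X Y - F X Z" for X Y Z by (simp add: F_def inner_diff_right)
  have minusL: "F (- X) Y = - F X Y" for X Y using scL[of "-1" X Y] by simp
  have minusR: "F X (- Y) = - F X Y" for X Y by (simp add: F_def)
  note F_lin = addL addR diffL diffR minusL minusR scL scR
  have FX: "F X (outer u v) = (G *v u) \<bullet> (X *v (G *v v))" for X u v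
    unfolding F_def by (rule FF)
  have FL: "F (outer u v) Y = (G *v u) \<bullet> (Y *v (G *v v))" for u v Y
  proof -
    have "G ** outer u v ** G = outer (G *v u) (G *v v)"
      by (simp add: matrix_eq outer_mult_vec matrix_vector_mult_scaleR inner_matrix_vector_sym[OF symG]
          flip: matrix_vector_mul_assoc)
    then show ?thesis by (simp add: F_def inner_outer inner_commute[of "outer _ _"])
  qed
  have Ky: "K *v y = w + s" by (simp add: w_def)
  have symK': "u \<bullet> (K *v v) = (K *v u) \<bullet> v" for u v by (simp add: inner_matrix_vector_sym[OF K])
  have sGw: "s \<bullet> (G *v w) = b" using inner_matrix_vector_sym[OF symG, of s w] by (simp add: Gs b_def)
  have rys: "y \<bullet> s = 1 / \<rho>" "s \<bullet> y = 1 / \<rho>" by (simp_all add: \<rho>_def inner_commute)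
  have "\<rho> > 0" using ys by (simp add: \<rho>_def)
  have wy: "w \<bullet> y = b" "y \<bullet> w = b" "(G *v w) \<bullet> s = b" "(G *v w) \<bullet> w = a" "w \<bullet> (G *v w) = a"
    using sGw by (simp_all add: b_def a_def inner_commute)
  have val: "inv_bfgs K s y = K + D"
    unfolding inv_bfgs_def Let_def w_def[symmetric] \<rho>_def[symmetric] D_def b_def
    by (simp add: algebra_simps)
  have KD: "F K D = - 2 * \<rho> * (a + b) + \<rho>\<^sup>2 * b * (b + 1 / \<rho>)"
    unfolding D_def
    by (simp add: F_lin FX Gs symK' Ky inner_add_left wy rys sGw)
      (simp add: symK'[symmetric] Ky inner_add_right wy rys sGw algebra_simps)
  have DK: "F D K = F K D"
    unfolding D_def by (simp add: F_lin FX FL)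
  have DD: "F D D = 2 * \<rho> * a - \<rho>\<^sup>2 * b\<^sup>2"
    unfolding D_def using \<open>\<rho> > 0\<close>
    by (simp add: F_lin FL outer_mult_vec Gs wy rys sGw)
      (simp add: field_simps power2_eq_square)
  have GD: "G \<bullet> D = - 2 * \<rho> * b + \<rho>\<^sup>2 * b * (1 / \<rho>)"
    unfolding D_def by (simp add: inner_add_right inner_diff_right inner_outer Gs wy rys sGw)
  have "bfgs_potential G (K + D) = F K K + F K D + F D K + F D D - 2 * (G \<bullet> K) - 2 * (G \<bullet> D)"
    by (simp add: bfgs_potential_def addL addR inner_add_right flip: F_def)
  also have "\<dots> = bfgs_potential G K - 2 * \<rho> * a + \<rho>\<^sup>2 * b\<^sup>2"
    unfolding DK KD DD GD bfgs_potential_def F_def[symmetric] using \<open>\<rho> > 0\<close>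
    by (simp add: field_simps power2_eq_square)
  \<comment> \<open>Cauchy-Schwarz for \<open>G\<close> at \<open>s\<close> and \<open>w\<close>:
    here \<open>b\<close> is \<open>s \<bullet> (G *v w)\<close> and
    \<open>s \<bullet> (G *v s)\<close> is \<open>1 / \<rho>\<close>, so the positive term uses up
    at most half of the decrease.\<close>
  also have "\<dots> \<le> bfgs_potential G K - \<rho> * a"
  proof -
    have "b\<^sup>2 \<le> (1 / \<rho>) * a"
      using spd_Cauchy_Schwarz[OF G, of s w] by (simp add: sGw Gs rys wy)
    then have "\<rho>\<^sup>2 * b\<^sup>2 \<le> \<rho>\<^sup>2 * ((1 / \<rho>) * a)" by (intro mult_left_mono) auto
    also have "\<dots> = \<rho> * a" using \<open>\<rho> > 0\<close> by (simp add: field_simps power2_eq_square)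
    finally show ?thesis by simp
  qed
  finally show ?thesis by (simp add: val \<rho>_def a_def)
qed

text \<open>The decrease holds for a weight that changes with every step, the summation needs a
  fixed one: this is the price of the exchange. With weight 0 on one side it also bounds the
  potential from below.\<close>

lemma abs_bfgs_potential_diff_le:
  fixes K G H :: "real^'p^'p"
  assumes K: "norm K \<le> C"
  shows "\<bar>bfgs_potential G K - bfgs_potential H K\<bar>
    \<le> norm (G - H) * (C\<^sup>2 * (norm G + norm H) + 2 * C)"
proof -
  have C: "C \<ge> 0" using K norm_ge_zero order_trans by blast
  have bd: "\<bar>(X ** K ** Y) \<bullet> K\<bar> \<le> C\<^sup>2 * (norm X * norm Y)" for X Y :: "real^'p^'p"
  proof -
    have "\<bar>(X ** K ** Y) \<bullet> K\<bar> \<le> norm (X ** K ** Y) * norm K" by (rule Cauchy_Schwarz_ineq2)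
    also have "\<dots> \<le> ((norm X * C) * norm Y) * C"
    proof (rule mult_mono)
      have "norm (X ** K ** Y) \<le> (norm X * norm K) * norm Y"
        by (meson norm_matrix_mult_le mult_right_mono norm_ge_zero order_trans)
      also have "\<dots> \<le> (norm X * C) * norm Y"
        by (intro mult_right_mono mult_left_mono K) auto
      finally show "norm (X ** K ** Y) \<le> (norm X * C) * norm Y" .
    qed (use K C in auto)
    finally show ?thesis by (simp add: power2_eq_square mult_ac)
  qed
  have "(G ** K ** G) = ((G - H) ** K ** G) + (H ** K ** (G - H)) + H ** K ** H"
    by (simp add: matrix_eq matrix_vector_mult_diff_rdistrib matrix_vector_mult_add_rdistrib
        matrix_vector_mult_diff_distrib flip: matrix_vector_mul_assoc)
  then have "bfgs_potential G K - bfgs_potential H K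
     = ((G - H) ** K ** G) \<bullet> K + (H ** K ** (G - H)) \<bullet> K - 2 * ((G - H) \<bullet> K)"
    by (simp add: bfgs_potential_def inner_add_left inner_diff_left)
  also have "\<bar>\<dots>\<bar> \<le> C\<^sup>2 * (norm (G - H) * norm G) + C\<^sup>2 * (norm H * norm (G - H)) + 2 * (norm (G - H) * C)"
  proof -
    have "\<bar>(G - H) \<bullet> K\<bar> \<le> norm (G - H) * C"
      by (meson Cauchy_Schwarz_ineq2 K mult_left_mono norm_ge_zero order_trans)
    then show ?thesis using bd[of "G - H" G] bd[of H "G - H"] by linarith
  qed
  finally show ?thesis by (simp add: algebra_simps)
qed

text \<open>The witness is the Powell symmetric Broyden update of \<open>H\<close>.\<close>

lemma symmetric_secant_perturbation:
  fixes H :: "real^'p^'p"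
  assumes H: "transpose H = H" and s: "s \<noteq> 0" and e: "norm (y - H *v s) \<le> \<eta> * norm s"
  obtains G where "transpose G = G" "G *v s = y" "norm (G - H) \<le> 3 * \<eta>"
proof
  define r where "r = y - H *v s"
  define c where "c = 1 / (s \<bullet> s)"
  let ?E = "c *\<^sub>R (outer r s + outer s r) - (c\<^sup>2 * (r \<bullet> s)) *\<^sub>R outer s s"
  have c: "c * (s \<bullet> s) = 1" "c > 0" using s by (simp_all add: c_def)
  show "transpose (H + ?E) = H + ?E"
  proof (rule symmetric_matrixI)
    fix u v
    show "((H + ?E) *v u) \<bullet> v = u \<bullet> ((H + ?E) *v v)"
      by (simp add: matrix_vector_mult_add_rdistrib matrix_vector_mult_diff_rdistrib outer_mult_vec
        inner_add_left inner_add_right inner_diff_left inner_diff_right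
        inner_commute algebra_simps flip: scaleR_matrix_vector_assoc)
        (metis H inner_commute inner_matrix_vector_sym)
  qed
  have "(c\<^sup>2 * (r \<bullet> s)) * (s \<bullet> s) = c * (r \<bullet> s)"
    using c by (simp add: power2_eq_square)
  then show "(H + ?E) *v s = y"
    using c by (simp add: matrix_vector_mult_add_rdistrib matrix_vector_mult_diff_rdistrib
        outer_mult_vec r_def[symmetric] algebra_simps flip: scaleR_matrix_vector_assoc)
      (use s in \<open>auto simp: r_def\<close>)
  have cs: "c * (norm s * norm s) = 1" using c by (simp add: dot_square_norm power2_eq_square)
  have r: "norm r \<le> \<eta> * norm s" using e by (simp add: r_def)
  have crs: "c * (norm r * norm s) \<le> \<eta>"
  proof -
    have "c * (norm r * norm s) \<le> c * ((\<eta> * norm s) * norm s)"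
      using r c by (intro mult_left_mono mult_right_mono) auto
    also have "\<dots> = \<eta> * (c * (norm s * norm s))" by (simp only: mult_ac)
    finally show ?thesis by (simp add: cs)
  qed
  have "norm ?E \<le> norm (c *\<^sub>R (outer r s + outer s r)) + norm ((c\<^sup>2 * (r \<bullet> s)) *\<^sub>R outer s s)"
    by (rule norm_triangle_ineq4)
  also have "\<dots> \<le> c * (norm r * norm s + norm s * norm r) + c\<^sup>2 * (norm r * norm s) * (norm s * norm s)"
  proof (intro add_mono)
    show "norm (c *\<^sub>R (outer r s + outer s r)) \<le> c * (norm r * norm s + norm s * norm r)"
      using c norm_triangle_ineq[of "outer r s" "outer s r"] by (simp add: norm_outer)
    show "norm ((c\<^sup>2 * (r \<bullet> s)) *\<^sub>R outer s s) \<le> c\<^sup>2 * (norm r * norm s) * (norm s * norm s)"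
      by (simp add: norm_outer abs_mult) (intro mult_right_mono mult_left_mono Cauchy_Schwarz_ineq2; simp)
  qed
  also have "\<dots> = 2 * (c * (norm r * norm s)) + (c * (norm r * norm s)) * (c * (norm s * norm s))"
    by (simp add: algebra_simps power2_eq_square)
  also have "\<dots> \<le> 3 * \<eta>" using crs by (simp add: cs)
  finally show "norm (H + ?E - H) \<le> 3 * \<eta>" by simp
qed

text \<open>The decrease is used for a secant matrix \<open>G\<close> near \<open>H\<close>, then
  compared with weight \<open>H\<close> at the old and at the new inverse. The condition
  \<open>6 * \<eta> \<le> \<mu>\<close> keeps \<open>G\<close> within \<open>\<mu> / 2\<close> of
  \<open>H\<close>, hence coercive with constant \<open>\<mu> / 2\<close>; the factor 6 in the error
  is 3 for each of the two comparisons.\<close>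

lemma bfgs_step_potential:
  fixes B H :: "real^'p^'p"
  assumes H: "transpose H = H" "\<And>v. \<mu> * (norm v)\<^sup>2 \<le> v \<bullet> (H *v v)" and mu: "0 < \<mu>"
    and B: "spd B" and ys: "0 < y \<bullet> s" "y \<bullet> s \<le> L * (norm s)\<^sup>2"
    and K: "norm (matrix_inv B) \<le> C" "norm (matrix_inv (bfgs_update B s y)) \<le> C"
    and e: "norm (y - H *v s) \<le> \<eta> * norm s" "6 * \<eta> \<le> \<mu>"
  shows "bfgs_potential H (matrix_inv (bfgs_update B s y))
    \<le> bfgs_potential H (matrix_inv B) - \<mu> / (2 * L) * (norm (matrix_inv B *v y - s) / norm s)\<^sup>2
       + 6 * (C\<^sup>2 * (2 * norm H + \<mu>) + 2 * C) * \<eta>"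
proof -
  let ?K = "matrix_inv B" and ?K' = "matrix_inv (bfgs_update B s y)"
  define w where "w = ?K *v y - s"
  have s: "s \<noteq> 0" using ys by auto
  have L: "L * (norm s)\<^sup>2 > 0" using ys by linarith
  then have "L > 0" using s by (simp add: zero_less_mult_iff)
  have C: "C \<ge> 0" using K(1) norm_ge_zero order_trans by blast
  obtain G where G: "transpose G = G" "G *v s = y" and GH: "norm (G - H) \<le> 3 * \<eta>"
    using symmetric_secant_perturbation[OF H(1) s e(1)] by blast
  have GH2: "norm (G - H) \<le> \<mu> / 2" using GH e(2) by linarith
  have Gco: "\<mu> / 2 * (norm v)\<^sup>2 \<le> v \<bullet> (G *v v)" for v
  proof -
    have "v \<bullet> (G *v v) = v \<bullet> (H *v v) + v \<bullet> ((G - H) *v v)"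
      by (simp add: matrix_vector_mult_diff_rdistrib inner_diff_right)
    moreover have "\<bar>v \<bullet> ((G - H) *v v)\<bar> \<le> norm v * ((\<mu> / 2) * norm v)"
      by (meson Cauchy_Schwarz_ineq2 GH2 mult_left_mono mult_right_mono norm_ge_zero
          norm_matrix_vector_mult_le order_trans)
    moreover have "norm v * ((\<mu> / 2) * norm v) = \<mu> / 2 * (norm v)\<^sup>2"
      by (simp add: power2_eq_square)
    ultimately show ?thesis using H(2)[of v] by linarith
  qed
  have G_spd: "spd G"
    unfolding spd_def using G(1) Gco mu by (smt (verit) zero_less_norm_iff mult_pos_pos zero_less_power half_gt_zero)
  have "norm G \<le> norm H + \<mu> / 2" using norm_triangle_ineq2[of G H] GH2 by linarith
  then have nGH: "norm G + norm H \<le> 2 * norm H + \<mu>" using mu by linarith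
  define R where "R = 3 * \<eta> * (C\<^sup>2 * (2 * norm H + \<mu>) + 2 * C)"
  have diff: "\<bar>bfgs_potential G X - bfgs_potential H X\<bar> \<le> R" if "norm X \<le> C" for X
  proof -
    have "\<bar>bfgs_potential G X - bfgs_potential H X\<bar>
      \<le> norm (G - H) * (C\<^sup>2 * (norm G + norm H) + 2 * C)"
      by (rule abs_bfgs_potential_diff_le[OF that])
    also have "\<dots> \<le> R"
      unfolding R_def
    proof (rule mult_mono[OF GH])
      show "C\<^sup>2 * (norm G + norm H) + 2 * C \<le> C\<^sup>2 * (2 * norm H + \<mu>) + 2 * C"
        using mult_left_mono[OF nGH, of "C\<^sup>2"] by simp
      show "0 \<le> 3 * \<eta>" using GH norm_ge_zero[of "G - H"] by linarith
    qed (use C in auto)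
    finally show ?thesis .
  qed
  have "bfgs_potential G ?K' \<le> bfgs_potential G ?K - (w \<bullet> (G *v w)) / (y \<bullet> s)"
    unfolding bfgs_update_spd(2)[OF B ys(1)] w_def
    by (rule bfgs_potential_step) (use spd_matrix_inv[OF B] G_spd G ys in \<open>auto simp: spd_def\<close>)
  moreover have "\<mu> / (2 * L) * (norm w / norm s)\<^sup>2 \<le> (w \<bullet> (G *v w)) / (y \<bullet> s)"
  proof -
    have "\<mu> / (2 * L) * (norm w / norm s)\<^sup>2 = (\<mu> / 2 * (norm w)\<^sup>2) / (L * (norm s)\<^sup>2)"
      by (simp add: power_divide)
    also have "\<dots> \<le> (w \<bullet> (G *v w)) / (y \<bullet> s)"
      by (rule frac_le) (use ys Gco[of w] spd_nonneg[OF G_spd] in auto)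
    finally show ?thesis .
  qed
  ultimately show ?thesis
    using diff[OF K(1)] diff[OF K(2)] unfolding w_def[symmetric] R_def by (simp add: algebra_simps)
qed

text \<open>Every term of the correction contains \<open>w\<close> once, and
  \<open>y \<bullet> s\<close> is at least of the order of the squared norm of \<open>s\<close>, so
  the powers of that norm cancel down to the quotient.\<close>

lemma norm_inv_bfgs_diff_le:
  fixes K :: "real^'p^'p"
  assumes s: "s \<noteq> 0" and m: "0 < m" "m * (norm s)\<^sup>2 \<le> y \<bullet> s" and M: "norm y \<le> M * norm s"
  shows "norm (inv_bfgs K s y - K) \<le> (2 / m + M / m\<^sup>2) * (norm (K *v y - s) / norm s)"
proof -
  define w where "w = K *v y - s"
  define \<rho> where "\<rho> = 1 / (y \<bullet> s)"
  define a where "a = norm s"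
  have a: "a > 0" using s by (simp add: a_def)
  have "0 < m * a\<^sup>2" using m a by simp
  then have rho: "0 < \<rho>" "\<rho> \<le> 1 / (m * a\<^sup>2)"
    using m(2) by (auto simp: \<rho>_def a_def intro!: divide_left_mono mult_pos_pos)
  have M0: "0 \<le> M" using M s by (metis norm_ge_zero order_trans zero_le_mult_iff norm_le_zero_iff)
  have "norm (inv_bfgs K s y - K)
    = norm ((\<rho>\<^sup>2 * (y \<bullet> w)) *\<^sub>R outer s s - \<rho> *\<^sub>R (outer s w + outer w s))"
    unfolding inv_bfgs_def Let_def w_def[symmetric] \<rho>_def[symmetric] by (simp add: algebra_simps)
  also have "\<dots> \<le> norm ((\<rho>\<^sup>2 * (y \<bullet> w)) *\<^sub>R outer s s) + norm (\<rho> *\<^sub>R (outer s w + outer w s))"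
    by (rule norm_triangle_ineq4)
  also have "\<dots> \<le> \<rho>\<^sup>2 * ((M * a) * norm w) * (a * a) + \<rho> * (2 * (a * norm w))"
  proof (rule add_mono)
    have "\<bar>y \<bullet> w\<bar> \<le> (M * a) * norm w"
      using M by (metis Cauchy_Schwarz_ineq2 a_def mult_right_mono norm_ge_zero order_trans)
    then show "norm ((\<rho>\<^sup>2 * (y \<bullet> w)) *\<^sub>R outer s s) \<le> \<rho>\<^sup>2 * ((M * a) * norm w) * (a * a)"
      by (simp add: norm_outer abs_mult a_def mult_left_mono mult_right_mono)
    show "norm (\<rho> *\<^sub>R (outer s w + outer w s)) \<le> \<rho> * (2 * (a * norm w))"
      using rho(1) norm_triangle_ineq[of "outer s w" "outer w s"]
      by (simp add: norm_outer a_def mult.commute)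
  qed
  also have "\<dots> \<le> (1 / (m * a\<^sup>2))\<^sup>2 * ((M * a) * norm w) * (a * a) + (1 / (m * a\<^sup>2)) * (2 * (a * norm w))"
    using rho a M0 by (intro add_mono mult_right_mono power_mono) auto
  also have "\<dots> = (2 / m + M / m\<^sup>2) * (norm w / a)"
    using a m(1) by (simp add: field_simps power2_eq_square)
  finally show ?thesis by (simp add: w_def a_def)
qed

text \<open>The identity behind this is \<open>A (A^-1 - B^-1) B = B - A\<close>.\<close>

lemma norm_diff_le_matrix_inv_diff:
  fixes A B :: "real^'p^'p"
  assumes "invertible A" "invertible B"
  shows "norm (A - B) \<le> norm A * norm (matrix_inv A - matrix_inv B) * norm B"
proof -
  have "(A ** (matrix_inv A - matrix_inv B) ** B) *v v = (B - A) *v v" for v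
    by (simp add: matrix_vector_mult_diff_rdistrib matrix_vector_mult_diff_distrib assms
        matrix_inv_vec flip: matrix_vector_mul_assoc)
  then have "A ** (matrix_inv A - matrix_inv B) ** B = B - A" by (simp add: matrix_eq)
  then have "norm (A - B) = norm (A ** (matrix_inv A - matrix_inv B) ** B)"
    by (simp add: norm_minus_commute)
  also have "\<dots> \<le> norm A * norm (matrix_inv A - matrix_inv B) * norm B"
    by (meson mult_right_mono norm_ge_zero norm_matrix_mult_le order_trans)
  finally show ?thesis .
qed

section \<open>Gradients and Hessians\<close>

text \<open>\<open>grad\<close> is a definite description, so existence and uniqueness are both due.
  The witness \<open>D\<close> represents the derivative through the inner product.\<close>

lemma GDERIV_grad:
  fixes f :: "'a::euclidean_space \<Rightarrow> real"
  assumes "f differentiable (at x)"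
  shows "GDERIV f x :> grad f x"
proof -
  obtain f' where f': "(f has_derivative f') (at x)" using assms by (auto simp: differentiable_def)
  then have lin: "linear f'" by (rule has_derivative_linear)
  define D where "D = (\<Sum>b\<in>Basis. f' b *\<^sub>R b)"
  have "f' h = h \<bullet> D" for h
  proof -
    have "f' (\<Sum>b\<in>Basis. (h \<bullet> b) *\<^sub>R b) = (\<Sum>b\<in>Basis. (h \<bullet> b) * f' b)"
      by (simp add: linear_sum[OF lin] linear_scale[OF lin])
    then show ?thesis by (simp add: euclidean_representation D_def inner_sum_right mult.commute)
  qed
  then have "f' = (\<lambda>h. h \<bullet> D)" by (rule ext)
  then have D: "GDERIV f x :> D" using f' by (simp add: gderiv_def)
  moreover have "D' = D" if "GDERIV f x :> D'" for D'
  proof (rule vector_eq_ldot[THEN iffD1], rule allI)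
    fix h
    have "(\<lambda>h. h \<bullet> D') = (\<lambda>h. h \<bullet> D)"
      using has_derivative_unique[OF that[unfolded gderiv_def] D[unfolded gderiv_def]] .
    then show "h \<bullet> D' = h \<bullet> D" by metis
  qed
  ultimately show ?thesis unfolding grad_def by (rule theI)
qed

lemma has_derivative_grad:
  assumes "twice_differentiable f"
  shows "(grad f has_derivative (\<lambda>h. hess f x *v h)) (at x)"
  using assms unfolding twice_differentiable_def hess_def by (simp flip: jacobian_works)

text \<open>Mean value inequality on the ball around \<open>p\<close> for the gradient minus its
  linear part at \<open>p\<close>: the derivative is a difference of Hessians, of norm at most
  \<open>Lt * \<sigma>\<close>.\<close>

lemma grad_linearization:
  fixes f :: "real^'p \<Rightarrow> real"
  assumes f: "twice_differentiable f"
    and lip: "\<And>v w. opnorm (hess f v - hess f w) \<le> Lt * norm (v - w)" and Lt: "0 \<le> Lt"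
    and v: "norm (v - p) \<le> \<sigma>" and w: "norm (w - p) \<le> \<sigma>"
  shows "norm (grad f v - grad f w - hess f p *v (v - w)) \<le> Lt * \<sigma> * norm (v - w)"
proof -
  let ?h = "\<lambda>u. grad f u - hess f p *v u"
  have "norm (?h v - ?h w) \<le> (Lt * \<sigma>) * norm (v - w)"
  proof (rule differentiable_bound[of "cball p \<sigma>"])
    fix u assume u: "u \<in> cball p \<sigma>"
    show "(?h has_derivative (\<lambda>d. (hess f u - hess f p) *v d)) (at u within cball p \<sigma>)"
      unfolding matrix_vector_mult_diff_rdistrib
      by (intro has_derivative_diff has_derivative_at_withinI[OF has_derivative_grad[OF f]]
          bounded_linear_imp_has_derivative matrix_vector_mul_bounded_linear)
    have "opnorm (hess f u - hess f p) \<le> Lt * norm (u - p)" by (rule lip)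
    also have "\<dots> \<le> Lt * \<sigma>"
      using u Lt by (intro mult_left_mono) (auto simp: dist_norm norm_minus_commute)
    finally show "opnorm (hess f u - hess f p) \<le> Lt * \<sigma>" .
  qed (use v w in \<open>auto simp: dist_norm norm_minus_commute\<close>)
  then show ?thesis by (simp add: algebra_simps)
qed

text \<open>Let \<open>h\<close> tend to 0. This serves Taylor-type estimates after division by
  \<open>h\<^sup>2\<close>.\<close>

lemma le_of_le_add_linear:
  fixes a b c :: real
  assumes "\<And>h. 0 < h \<Longrightarrow> a \<le> b + c * h"
  shows "a \<le> b"
proof (rule tendsto_lowerbound)
  show "((\<lambda>h. b + c * h) \<longlongrightarrow> b) (at_right 0)" by (auto intro!: tendsto_eq_intros)
  show "\<forall>\<^sub>F h in at_right 0. a \<le> b + c * h"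
    using assms by (auto simp: eventually_at_right_field intro!: exI[of _ 1])
qed simp

text \<open>The second difference \<open>\<phi> a b h\<close> is symmetric in \<open>a\<close> and
  \<open>b\<close> and equals \<open>h\<^sup>2\<close> times the Hessian form up to a cubic error.
  The two orders are compared as \<open>h\<close> tends to 0.\<close>

lemma hess_symmetric:
  fixes f :: "real^'p \<Rightarrow> real"
  assumes f: "twice_differentiable f"
    and lip: "\<And>v w. opnorm (hess f v - hess f w) \<le> Lt * norm (v - w)" and Lt: "0 \<le> Lt"
  shows "transpose (hess f p) = hess f p"
proof (rule symmetric_matrixI)
  fix u v
  define \<phi> where "\<phi> a b h = f (p + h *\<^sub>R a + h *\<^sub>R b) - f (p + h *\<^sub>R a) - f (p + h *\<^sub>R b) + f p"
    for a b h
  define Q where "Q a b = Lt * (norm a + norm b) * norm a * norm b" for a b :: "real^'p"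
  have der: "((\<lambda>\<tau>. f (q + \<tau> *\<^sub>R b)) has_real_derivative (b \<bullet> grad f (q + \<tau> *\<^sub>R b))) (at \<tau>)" for q b \<tau>
  proof -
    have "GDERIV f (q + \<tau> *\<^sub>R b) :> grad f (q + \<tau> *\<^sub>R b)"
      using f by (intro GDERIV_grad) (auto simp: twice_differentiable_def)
    then have "(f has_derivative (\<lambda>h. h \<bullet> grad f (q + \<tau> *\<^sub>R b))) (at (q + \<tau> *\<^sub>R b))"
      by (simp add: gderiv_def)
    then have "((\<lambda>\<tau>. f (q + \<tau> *\<^sub>R b)) has_derivative (\<lambda>d. (d *\<^sub>R b) \<bullet> grad f (q + \<tau> *\<^sub>R b))) (at \<tau>)"
      by (rule has_derivative_compose[rotated]) (auto intro!: derivative_eq_intros)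
    then show ?thesis by (simp add: has_field_derivative_def mult_commute_abs)
  qed
  have main: "\<bar>\<phi> a b h - h\<^sup>2 * (b \<bullet> (hess f p *v a))\<bar> \<le> Q a b * h ^ 3" if h: "0 < h" for a b h
  proof -
    \<comment> \<open>The increment of \<open>?\<psi>\<close> over \<open>[0, h]\<close> is the
      second difference, so the mean value theorem reduces it to a difference of gradients.\<close>
    let ?\<psi> = "\<lambda>\<tau>. f ((p + h *\<^sub>R a) + \<tau> *\<^sub>R b) - f (p + \<tau> *\<^sub>R b)"
    let ?\<psi>' = "\<lambda>\<tau>. b \<bullet> grad f ((p + h *\<^sub>R a) + \<tau> *\<^sub>R b) - b \<bullet> grad f (p + \<tau> *\<^sub>R b)"
    have "\<exists>\<tau>>0. \<tau> < h \<and> ?\<psi> h - ?\<psi> 0 = (h - 0) * ?\<psi>' \<tau>"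
      by (rule MVT2[OF h]) (intro DERIV_diff der)
    then obtain \<tau> where \<tau>: "0 < \<tau>" "\<tau> < h" and eq: "\<phi> a b h = h * ?\<psi>' \<tau>"
      by (auto simp: \<phi>_def algebra_simps)
    let ?v = "(p + h *\<^sub>R a) + \<tau> *\<^sub>R b" and ?w = "p + \<tau> *\<^sub>R b"
    let ?r = "grad f ?v - grad f ?w - hess f p *v (?v - ?w)"
    have tb: "\<tau> * norm b \<le> h * norm b" using \<tau> by (intro mult_right_mono) auto
    have "norm ?r \<le> Lt * (h * (norm a + norm b)) * norm (?v - ?w)"
    proof (rule grad_linearization[OF f lip Lt])
      show "norm (?v - p) \<le> h * (norm a + norm b)"
        using norm_triangle_ineq[of "h *\<^sub>R a" "\<tau> *\<^sub>R b"] tb \<tau> h by (simp add: algebra_simps)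
      show "norm (?w - p) \<le> h * (norm a + norm b)"
        using tb \<tau> h by (simp add: algebra_simps add_increasing)
    qed
    then have r: "norm ?r \<le> Lt * (h * (norm a + norm b)) * (h * norm a)" using h by simp
    have "\<phi> a b h - h\<^sup>2 * (b \<bullet> (hess f p *v a)) = h * (b \<bullet> ?r)"
      by (simp add: eq inner_diff_right matrix_vector_mult_scaleR algebra_simps power2_eq_square)
    also have "\<bar>\<dots>\<bar> \<le> h * (norm b * (Lt * (h * (norm a + norm b)) * (h * norm a)))"
      unfolding abs_mult abs_of_pos[OF h]
      by (intro mult_left_mono order_trans[OF Cauchy_Schwarz_ineq2] r) (use h in auto)
    finally show ?thesis by (simp add: Q_def power3_eq_cube mult_ac)
  qed
  have "\<bar>v \<bullet> (hess f p *v u) - u \<bullet> (hess f p *v v)\<bar> \<le> 0"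
  proof (rule le_of_le_add_linear[where c = "Q u v + Q v u"])
    fix h :: real assume h: "0 < h"
    have sym: "\<phi> v u h = \<phi> u v h" by (simp add: \<phi>_def algebra_simps)
    have "h\<^sup>2 * \<bar>v \<bullet> (hess f p *v u) - u \<bullet> (hess f p *v v)\<bar>
      = \<bar>h\<^sup>2 * (v \<bullet> (hess f p *v u)) - h\<^sup>2 * (u \<bullet> (hess f p *v v))\<bar>"
      by (simp add: abs_mult flip: right_diff_distrib)
    also have "\<dots> \<le> Q u v * h ^ 3 + Q v u * h ^ 3"
      using main[OF h, of u v] main[OF h, of v u] unfolding sym by linarith
    also have "\<dots> = h\<^sup>2 * (0 + (Q u v + Q v u) * h)"
      by (simp add: power2_eq_square power3_eq_cube algebra_simps)
    finally show "\<bar>v \<bullet> (hess f p *v u) - u \<bullet> (hess f p *v v)\<bar> \<le> 0 + (Q u v + Q v u) * h"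
      using h by simp
  qed
  then show "(hess f p *v u) \<bullet> v = u \<bullet> (hess f p *v v)" by (simp add: inner_commute)
qed

text \<open>Strong monotonicity between \<open>p\<close> and \<open>p + h *\<^sub>R v\<close>,
  divided by \<open>h\<^sup>2\<close> as \<open>h\<close> tends to 0.\<close>

lemma hess_coercive:
  fixes f :: "real^'p \<Rightarrow> real"
  assumes f: "twice_differentiable f"
    and lip: "\<And>v w. opnorm (hess f v - hess f w) \<le> Lt * norm (v - w)" and Lt: "0 \<le> Lt"
    and mono: "\<And>v w. \<mu> * (norm (v - w))\<^sup>2 \<le> (grad f v - grad f w) \<bullet> (v - w)"
  shows "\<mu> * (norm v)\<^sup>2 \<le> v \<bullet> (hess f p *v v)"
proof (rule le_of_le_add_linear[where c = "Lt * norm v ^ 3"])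
  fix h :: real assume h: "0 < h"
  let ?r = "grad f (p + h *\<^sub>R v) - grad f p - hess f p *v (p + h *\<^sub>R v - p)"
  have "norm ?r \<le> Lt * (h * norm v) * norm (p + h *\<^sub>R v - p)"
    by (rule grad_linearization[OF f lip Lt]) (use h in auto)
  then have r: "norm ?r \<le> Lt * (h * norm v) * (h * norm v)" using h by simp
  have "h\<^sup>2 * (\<mu> * (norm v)\<^sup>2) = \<mu> * (norm (p + h *\<^sub>R v - p))\<^sup>2"
    using h by (simp add: power_mult_distrib)
  also have "\<dots> \<le> (grad f (p + h *\<^sub>R v) - grad f p) \<bullet> (p + h *\<^sub>R v - p)" by (rule mono)
  also have "\<dots> = h\<^sup>2 * (v \<bullet> (hess f p *v v)) + h * (?r \<bullet> v)"
    by (simp add: matrix_vector_mult_scaleR inner_diff_left inner_commute power2_eq_square algebra_simps)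
  also have "h * (?r \<bullet> v) \<le> h * ((Lt * (h * norm v) * (h * norm v)) * norm v)"
    using r h by (intro mult_left_mono) (meson norm_cauchy_schwarz mult_right_mono norm_ge_zero order_trans, simp)
  also have "\<dots> = h\<^sup>2 * (Lt * norm v ^ 3 * h)"
    by (simp add: power2_eq_square power3_eq_cube mult_ac)
  finally have "h\<^sup>2 * (\<mu> * (norm v)\<^sup>2) \<le> h\<^sup>2 * (v \<bullet> (hess f p *v v) + Lt * norm v ^ 3 * h)"
    by (simp add: algebra_simps)
  then show "\<mu> * (norm v)\<^sup>2 \<le> v \<bullet> (hess f p *v v) + Lt * norm v ^ 3 * h"
    using h by simp
qed

lemma sum_grad_eq_0_at_minimizer:
  fixes f :: "nat \<Rightarrow> 'a::euclidean_space \<Rightarrow> real"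
  assumes diff: "\<And>i. i \<in> I \<Longrightarrow> f i differentiable (at p)" and c: "0 < c"
    and min: "\<And>w. c * (\<Sum>i\<in>I. f i p) \<le> c * (\<Sum>i\<in>I. f i w)"
  shows "(\<Sum>i\<in>I. grad (f i) p) = 0"
proof -
  have "((\<lambda>w. \<Sum>i\<in>I. f i w) has_derivative (\<lambda>h. \<Sum>i\<in>I. h \<bullet> grad (f i) p)) (at p)"
    using GDERIV_grad[OF diff] by (intro has_derivative_sum) (simp add: gderiv_def)
  then have "(\<lambda>h. \<Sum>i\<in>I. h \<bullet> grad (f i) p) = (\<lambda>h. 0)"
    by (rule has_derivative_local_min) (use min c in simp)
  then have "h \<bullet> (\<Sum>i\<in>I. grad (f i) p) = 0" for h
    by (metis inner_sum_right)
  then show ?thesis by (metis inner_eq_zero_iff)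
qed

section \<open>Superlinear convergence from secant conditions\<close>

lemma norm_smallo_bound:
  assumes "\<forall>\<^sub>F t in F. norm (u t) \<le> f t" "f \<in> o[F](W)"
  shows "(\<lambda>t. norm (u t)) \<in> o[F](W :: 'b \<Rightarrow> real)"
proof (rule landau_o.big_small_trans[OF _ assms(2)])
  show "(\<lambda>t. norm (u t)) \<in> O[F](f)"
    by (rule bigoI[where c = 1]) (use assms(1) in \<open>auto elim!: eventually_mono\<close>)
qed

lemma norm_smallo_add:
  assumes "(\<lambda>t. norm (u t)) \<in> o[F](W)" "(\<lambda>t. norm (v t)) \<in> o[F](W :: 'b \<Rightarrow> real)"
  shows "(\<lambda>t. norm (u t + v t)) \<in> o[F](W)"
  by (rule norm_smallo_bound[OF _ sum_in_smallo(1)[OF assms]]) (simp add: norm_triangle_ineq)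

lemma norm_smallo_diff:
  assumes "(\<lambda>t. norm (u t)) \<in> o[F](W)" "(\<lambda>t. norm (v t)) \<in> o[F](W :: 'b \<Rightarrow> real)"
  shows "(\<lambda>t. norm (u t - v t)) \<in> o[F](W)"
  by (rule norm_smallo_bound[OF _ sum_in_smallo(1)[OF assms]]) (simp add: norm_triangle_ineq4)

lemma norm_smallo_sum:
  assumes "\<And>i. i \<in> I \<Longrightarrow> (\<lambda>t. norm (u i t)) \<in> o[F](W :: 'b \<Rightarrow> real)"
  shows "(\<lambda>t. norm (\<Sum>i\<in>I. u i t)) \<in> o[F](W)"
  by (rule norm_smallo_bound[OF _ big_sum_in_smallo[OF assms]]) (simp_all add: norm_sum)

lemma norm_smallo_matrix_vector_mult:
  fixes A :: "'b \<Rightarrow> real^'n^'m"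
  assumes "\<And>t. norm (A t) \<le> C" "(\<lambda>t. norm (v t)) \<in> o[F](W :: 'b \<Rightarrow> real)"
  shows "(\<lambda>t. norm (A t *v v t)) \<in> o[F](W)"
proof (rule norm_smallo_bound)
  show "\<forall>\<^sub>F t in F. norm (A t *v v t) \<le> C * norm (v t)"
    by (intro always_eventually allI order_trans[OF norm_matrix_vector_mult_le] mult_right_mono assms) simp
  show "(\<lambda>t. C * norm (v t)) \<in> o[F](W)" using assms(2) by simp
qed

lemma norm_smallo_vanishing_matrix_vector_mult:
  fixes A :: "'b \<Rightarrow> real^'n^'m"
  assumes "((\<lambda>t. norm (A t)) \<longlongrightarrow> 0) F" "(\<lambda>t. norm (v t)) \<in> O[F](W :: 'b \<Rightarrow> real)"
  shows "(\<lambda>t. norm (A t *v v t)) \<in> o[F](W)"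
proof (rule norm_smallo_bound)
  show "\<forall>\<^sub>F t in F. norm (A t *v v t) \<le> norm (A t) * norm (v t)"
    by (simp add: norm_matrix_vector_mult_le)
  have "(\<lambda>t. norm (A t)) \<in> o[F](\<lambda>_. 1)" by (rule smalloI_tendsto) (use assms(1) in auto)
  from landau_o.small_big_mult[OF this assms(2)]
  show "(\<lambda>t. norm (A t) * norm (v t)) \<in> o[F](W)" by simp
qed

text \<open>One step of the method changes a single component, so increments of sums over all
  components reduce to one term.\<close>

lemma sum_diff_single:
  fixes f g :: "'i \<Rightarrow> 'a::ab_group_add"
  assumes "finite I" "k \<in> I" "\<And>i. i \<in> I \<Longrightarrow> i \<noteq> k \<Longrightarrow> f i = g i"
  shows "sum f I - sum g I = f k - g k"
proof -
  have "sum f (I - {k}) = sum g (I - {k})" using assms(3) by (intro sum.cong) auto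
  then show ?thesis using assms(1,2) by (simp add: sum.remove[of I k])
qed

lemma sum_matrix_vector_mult: "(\<Sum>i\<in>I. A i) *v v = (\<Sum>i\<in>I. A i *v (v :: real^'n))"
  by (induction I rule: infinite_finite_induct) (simp_all add: matrix_vector_mult_add_rdistrib)

text \<open>The convergence argument detached from BFGS: \<open>Z i t\<close> plays the role of
  \<open>z i t - xs\<close>, \<open>secant\<close> and \<open>drift\<close> summarize the matrix
  updates, and \<open>gap\<close> is the step equation up to the linearization error.\<close>

lemma incremental_superlinear:
  fixes e :: "nat \<Rightarrow> real^'p" and Z :: "nat \<Rightarrow> nat \<Rightarrow> real^'p"
    and B :: "nat \<Rightarrow> nat \<Rightarrow> real^'p^'p" and H :: "nat \<Rightarrow> real^'p^'p"
  assumes idx: "\<And>t. idx t \<in> {1..n}"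
    and Z: "\<And>t i. n \<le> t \<Longrightarrow> i \<in> {1..n} \<Longrightarrow> \<exists>j<n. Z i t = e (t - j)"
    and Z_new: "\<And>t. Z (idx t) (Suc t) = e (Suc t)"
    and keep: "\<And>t i. i \<in> {1..n} \<Longrightarrow> i \<noteq> idx t \<Longrightarrow> Z i (Suc t) = Z i t \<and> B i (Suc t) = B i t"
    and bounded: "\<And>t i. i \<in> {1..n} \<Longrightarrow> norm (B i t) \<le> C"
    and B_lower: "0 < c" "\<And>t v. c * norm v \<le> norm ((\<Sum>i=1..n. B i t) *v v)"
    and H_lower: "0 < d" "\<And>v. d * norm v \<le> norm ((\<Sum>i=1..n. H i) *v v)"
    and secant: "\<kappa> \<longlonglongrightarrow> 0"
      "\<forall>\<^sub>F t in sequentially. norm ((B (idx t) t - H (idx t)) *v (e (Suc t) - Z (idx t) t))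
          \<le> \<kappa> t * norm (e (Suc t) - Z (idx t) t)"
    and drift: "(\<lambda>t. norm (B (idx t) (Suc t) - B (idx t) t)) \<longlonglongrightarrow> 0"
  defines "W \<equiv> \<lambda>t. \<Sum>j<n. norm (e (t - j))"
  assumes gap: "(\<lambda>t. norm ((\<Sum>i=1..n. B i t) *v e (Suc t) - (\<Sum>i=1..n. (B i t - H i) *v Z i t)))
      \<in> o(W)"
  shows "(\<lambda>t. norm (e (Suc t))) \<in> o(W)"
proof -
  define S where "S t = (\<Sum>i=1..n. B i t)" for t
  define g where "g t = (\<Sum>i=1..n. (B i t - H i) *v Z i t)" for t
  define D where "D = (\<Sum>i=1..n. C + norm (H i))"
  have W_nonneg: "0 \<le> W t" for t by (simp add: W_def sum_nonneg)
  have gap': "(\<lambda>t. norm (S t *v e (Suc t) - g t)) \<in> o(W)" using gap by (simp add: S_def g_def)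
  have D_bound: "norm (B i t - H i) \<le> C + norm (H i)" if "i \<in> {1..n}" for i t
    using norm_triangle_ineq4[of "B i t" "H i"] bounded[OF that, of t] by linarith
  have Z_le: "norm (Z i t) \<le> W t" if t: "n \<le> t" and i: "i \<in> {1..n}" for i t
  proof -
    obtain j where "j < n" "Z i t = e (t - j)" using Z[OF t i] by blast
    then show ?thesis
      unfolding W_def by (simp add: member_le_sum[of j "{..<n}" "\<lambda>j. norm (e (t - j))"])
  qed
  have g_le: "norm (g t) \<le> D * W t" if "n \<le> t" for t
  proof -
    have "norm (g t) \<le> (\<Sum>i=1..n. norm ((B i t - H i) *v Z i t))"
      unfolding g_def by (rule norm_sum)
    also have "\<dots> \<le> (\<Sum>i=1..n. (C + norm (H i)) * W t)"
      by (intro sum_mono order_trans[OF norm_matrix_vector_mult_le] mult_mono D_bound Z_le that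
          order_trans[OF norm_ge_zero D_bound]) auto
    finally show ?thesis by (simp add: D_def sum_distrib_right)
  qed
  \<comment> \<open>The uniform lower bound lets \<open>S t\<close> be cancelled inside little-o
    estimates.\<close>
  have S_inverse_small: "(\<lambda>t. norm (v t)) \<in> o(W)" if "(\<lambda>t. norm (S t *v v t)) \<in> o(W)" for v
  proof (rule landau_o.big_small_trans[OF _ that])
    show "(\<lambda>t. norm (v t)) \<in> O(\<lambda>t. norm (S t *v v t))"
      by (rule bigoI[where c = "1 / c"])
        (use B_lower in \<open>auto simp: S_def field_simps intro!: always_eventually\<close>)
  qed
  \<comment> \<open>A priori bound: both \<open>g\<close> and the gap are of order
    \<open>W\<close>.\<close>
  have e_big: "(\<lambda>t. norm (e (Suc t))) \<in> O(W)"
  proof -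
    have "(\<lambda>t. norm (g t)) \<in> O(W)"
      by (rule bigoI[where c = D])
        (use g_le W_nonneg in \<open>auto simp: eventually_sequentially intro!: exI[of _ n]\<close>)
    then have big: "(\<lambda>t. norm (S t *v e (Suc t) - g t) + norm (g t)) \<in> O(W)"
      using landau_o.small_imp_big[OF gap'] by (intro sum_in_bigo)
    show ?thesis
    proof (rule landau_o.big_trans[OF _ big], rule bigoI[where c = "1 / c"],
        intro always_eventually allI)
      fix t
      have "norm (S t *v e (Suc t)) \<le> norm (S t *v e (Suc t) - g t) + norm (g t)"
        using norm_triangle_ineq[of "S t *v e (Suc t) - g t" "g t"] by simp
      then have "c * norm (e (Suc t)) \<le> norm (S t *v e (Suc t) - g t) + norm (g t)"
        using B_lower(2)[of "e (Suc t)" t] by (simp add: S_def)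
      then show "norm (norm (e (Suc t)))
          \<le> 1 / c * norm (norm (S t *v e (Suc t) - g t) + norm (g t))"
        using B_lower(1) by (simp add: field_simps)
    qed
  qed
  have shift: "filterlim (\<lambda>t. t + j) sequentially sequentially" for j :: nat
    by (rule filterlim_add_const_nat_at_top)
  \<comment> \<open>The new window lies in the old one enlarged by \<open>e (Suc t)\<close>. With
    \<open>e_big\<close>, estimates relative to shifted windows can then be read relative to
    \<open>W\<close> itself.\<close>
  have W_Suc: "W (Suc t) \<le> norm (e (Suc t)) + W t" for t
  proof -
    have "W (Suc t) \<le> (\<Sum>j<Suc n. norm (e (Suc t - j)))"
      unfolding W_def by (rule sum_mono2) auto
    then show ?thesis by (simp add: W_def sum.lessThan_Suc_shift del: sum.lessThan_Suc)
  qed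
  have "(\<lambda>t. W (Suc t)) \<in> O(W)"
  proof (rule landau_o.big_trans)
    show "(\<lambda>t. W (Suc t)) \<in> O(\<lambda>t. norm (e (Suc t)) + W t)"
      by (rule bigoI[where c = 1]) (use W_Suc W_nonneg in \<open>auto intro!: always_eventually\<close>)
    show "(\<lambda>t. norm (e (Suc t)) + W t) \<in> O(W)" by (intro sum_in_bigo e_big) simp
  qed
  note W_Suc_big = this
  have W_shift: "(\<lambda>t. W (t + j)) \<in> O(W)" for j
  proof (induction j)
    case (Suc j)
    have "(\<lambda>t. W (Suc (t + j))) \<in> O(\<lambda>t. W (t + j))"
      by (rule landau_o.big.compose[OF W_Suc_big shift])
    then show ?case using Suc landau_o.big_trans by fastforce
  qed simp
  have e_shift: "(\<lambda>t. norm (e (Suc (t + j)))) \<in> O(W)" for j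
    using landau_o.big_trans[OF landau_o.big.compose[OF e_big shift] W_shift] .
  have S_step: "S (Suc t) - S t = B (idx t) (Suc t) - B (idx t) t" for t
    unfolding S_def by (rule sum_diff_single) (use idx keep in auto)
  have S_drift: "(\<lambda>t. norm (S (t + j) - S t)) \<longlonglongrightarrow> 0" for j
  proof (induction j)
    case (Suc j)
    have "(\<lambda>t. norm (S (Suc t) - S t)) \<longlonglongrightarrow> 0" using drift by (simp add: S_step)
    then have step: "(\<lambda>t. norm (S (Suc (t + j)) - S (t + j))) \<longlonglongrightarrow> 0"
      by (rule filterlim_compose[OF _ shift])
    have "(\<lambda>t. norm (S (Suc (t + j)) - S (t + j)) + norm (S (t + j) - S t)) \<longlonglongrightarrow> 0"
      using tendsto_add[OF step Suc] by simp
    then show ?case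
      by (rule Lim_null_comparison[rotated])
        (intro always_eventually allI, simp, metis diff_add_cancel add_diff_eq norm_triangle_ineq)
  qed simp
  \<comment> \<open>The increment is split so that \<open>secant\<close> controls the first part and
    \<open>drift\<close> the second.\<close>
  have g_step: "g (Suc t) - g t = (B (idx t) t - H (idx t)) *v (e (Suc t) - Z (idx t) t)
      + (B (idx t) (Suc t) - B (idx t) t) *v e (Suc t)" for t
  proof -
    have "g (Suc t) - g t = (B (idx t) (Suc t) - H (idx t)) *v Z (idx t) (Suc t)
        - (B (idx t) t - H (idx t)) *v Z (idx t) t"
      unfolding g_def by (rule sum_diff_single) (use idx keep in auto)
    then show ?thesis
      by (simp add: Z_new matrix_vector_mult_diff_distrib matrix_vector_mult_diff_rdistrib)
  qed
  have "(\<lambda>t. norm ((B (idx t) t - H (idx t)) *v (e (Suc t) - Z (idx t) t))) \<in> o(W)"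
  proof (rule norm_smallo_bound[OF secant(2)])
    have kappa: "\<kappa> \<in> o(\<lambda>_. 1)" by (rule smalloI_tendsto) (use secant(1) in auto)
    have "(\<lambda>t. norm (e (Suc t) - Z (idx t) t)) \<in> O(W)"
    proof (rule landau_o.big_trans)
      show "(\<lambda>t. norm (e (Suc t) - Z (idx t) t)) \<in> O(\<lambda>t. norm (e (Suc t)) + W t)"
      proof (rule bigoI[where c = 1], rule eventually_mono[OF eventually_ge_at_top[of n]])
        fix t assume "n \<le> t"
        then show "norm (norm (e (Suc t) - Z (idx t) t)) \<le> 1 * norm (norm (e (Suc t)) + W t)"
          using norm_triangle_ineq4[of "e (Suc t)" "Z (idx t) t"] Z_le[OF _ idx, of t t] W_nonneg[of t]
          by simp
      qed
      show "(\<lambda>t. norm (e (Suc t)) + W t) \<in> O(W)" by (intro sum_in_bigo e_big) simp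
    qed
    from landau_o.small_big_mult[OF kappa this]
    show "(\<lambda>t. \<kappa> t * norm (e (Suc t) - Z (idx t) t)) \<in> o(W)" by simp
  qed
  then have g_Suc: "(\<lambda>t. norm (g (Suc t) - g t)) \<in> o(W)"
    unfolding g_step
    by (intro norm_smallo_add norm_smallo_vanishing_matrix_vector_mult[OF drift e_big])
  have g_drift: "(\<lambda>t. norm (g (t + j) - g t)) \<in> o(W)" for j
  proof (induction j)
    case (Suc j)
    have "(\<lambda>t. norm (g (Suc (t + j)) - g (t + j))) \<in> o(W)"
      using landau_o.small_big_trans[OF landau_o.small.compose[OF g_Suc shift] W_shift] .
    from norm_smallo_add[OF this Suc] show ?case by simp
  qed simp
  have e_drift: "(\<lambda>t. norm (e (Suc (t + j)) - e (Suc t))) \<in> o(W)" for j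
  proof (rule S_inverse_small)
    have "(\<lambda>t. norm (S (t + j) *v e (Suc (t + j)) - g (t + j))) \<in> o(W)"
      using landau_o.small_big_trans[OF landau_o.small.compose[OF gap' shift] W_shift] .
    \<comment> \<open>The vector is the gap at \<open>t + j\<close>, plus the change of
      \<open>g\<close>, minus the change of \<open>S\<close> applied to
      \<open>e (Suc (t + j))\<close>, minus the gap at \<open>t\<close>.\<close>
    from norm_smallo_diff[OF norm_smallo_diff[OF norm_smallo_add[OF this g_drift[of j]]
          norm_smallo_vanishing_matrix_vector_mult[OF S_drift[of j] e_shift[of j]]] gap']
    show "(\<lambda>t. norm (S t *v (e (Suc (t + j)) - e (Suc t)))) \<in> o(W)"
      by (simp add: matrix_vector_mult_diff_distrib matrix_vector_mult_diff_rdistrib)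
  qed
  have Z_near: "(\<lambda>t. norm (Z i (t + n) - e (Suc t))) \<in> o(W)" if i: "i \<in> {1..n}" for i
  proof (rule norm_smallo_bound)
    show "\<forall>\<^sub>F t in sequentially. norm (Z i (t + n) - e (Suc t)) \<le> (\<Sum>j<n. norm (e (Suc (t + j)) - e (Suc t)))"
    proof (intro always_eventually allI)
      fix t
      obtain j where j: "j < n" "Z i (t + n) = e (t + n - j)" using Z[of "t + n" i] i by auto
      \<comment> \<open>For \<open>j < n\<close> the index lies between \<open>t + 1\<close> and
        \<open>t + n\<close>, so only errors made during the cycle occur.\<close>
      moreover have "t + n - j = Suc (t + (n - 1 - j))" using j(1) by arith
      ultimately have "Z i (t + n) = e (Suc (t + (n - 1 - j)))" by metis
      then show "norm (Z i (t + n) - e (Suc t)) \<le> (\<Sum>j<n. norm (e (Suc (t + j)) - e (Suc t)))"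
        using j(1) member_le_sum[of "n - 1 - j" "{..<n}" "\<lambda>j. norm (e (Suc (t + j)) - e (Suc t))"]
        by simp
    qed
    show "(\<lambda>t. \<Sum>j<n. norm (e (Suc (t + j)) - e (Suc t))) \<in> o(W)"
      by (intro big_sum_in_smallo e_drift)
  qed
  \<comment> \<open>After a full cycle every \<open>Z i\<close> is within little-o of the single
    error \<open>e (Suc t)\<close>, and the matrices are bounded.\<close>
  have "(\<lambda>t. norm (\<Sum>i=1..n. (B i (t + n) - H i) *v (Z i (t + n) - e (Suc t)))) \<in> o(W)"
    by (intro norm_smallo_sum norm_smallo_matrix_vector_mult[OF D_bound Z_near])
  moreover have "(\<Sum>i=1..n. (B i (t + n) - H i) *v (Z i (t + n) - e (Suc t)))
      = g (t + n) - S (t + n) *v e (Suc t) + (\<Sum>i=1..n. H i) *v e (Suc t)" for t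
    by (simp add: g_def S_def matrix_vector_mult_diff_distrib matrix_vector_mult_diff_rdistrib
        sum_subtractf sum_matrix_vector_mult)
  ultimately have "(\<lambda>t. norm (g (t + n) - S (t + n) *v e (Suc t) + (\<Sum>i=1..n. H i) *v e (Suc t))) \<in> o(W)"
    by simp
  \<comment> \<open>Adding the change of \<open>S\<close> applied to \<open>e (Suc t)\<close>,
    subtracting the change of \<open>g\<close> and adding the gap at \<open>t\<close> cancels
    everything but the Hessian term.\<close>
  from norm_smallo_add[OF norm_smallo_diff[OF norm_smallo_add[OF this
        norm_smallo_vanishing_matrix_vector_mult[OF S_drift[of n] e_big]] g_drift[of n]] gap']
  have "(\<lambda>t. norm ((\<Sum>i=1..n. H i) *v e (Suc t))) \<in> o(W)"
    by (simp add: matrix_vector_mult_diff_rdistrib)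
  then show ?thesis
  proof (rule landau_o.big_small_trans[rotated])
    show "(\<lambda>t. norm (e (Suc t))) \<in> O(\<lambda>t. norm ((\<Sum>i=1..n. H i) *v e (Suc t)))"
      by (rule bigoI[where c = "1 / d"])
        (use H_lower in \<open>auto simp: field_simps intro!: always_eventually\<close>)
  qed
qed

section \<open>The IQN method\<close>

text \<open>Telescoping: a quantity bounded below can lose only a finite total, up to the summable
  perturbation \<open>b\<close>. The step is asked only from \<open>T\<close> on, since the
  potential estimate holds once the errors are small.\<close>

lemma tendsto_0_of_summable_decrease:
  fixes V q b :: "nat \<Rightarrow> real"
  assumes step: "\<And>t. T \<le> t \<Longrightarrow> V (Suc t) \<le> V t - q t + b t"
    and q: "\<And>t. 0 \<le> q t" and b: "\<And>t. 0 \<le> b t" "summable b" and V: "\<And>t. l \<le> V t"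
  shows "q \<longlonglongrightarrow> 0"
proof -
  have sum_q: "(\<Sum>t<m. q (t + T)) \<le> V T - V (m + T) + (\<Sum>t<m. b (t + T))" for m
  proof (induction m)
    case (Suc m)
    then show ?case using step[of "m + T"] by simp
  qed simp
  have b_T: "summable (\<lambda>t. b (t + T))" using b(2) by (simp add: summable_iff_shift)
  have "summable (\<lambda>t. q (t + T))"
  proof (rule summableI_nonneg_bounded)
    fix m
    show "(\<Sum>t<m. q (t + T)) \<le> V T - l + (\<Sum>t. b (t + T))"
      using sum_q[of m] V[of "m + T"] sum_le_suminf[OF b_T, of "{..<m}"] b(1) by simp
  qed (rule q)
  then have "summable q" by (simp add: summable_iff_shift)
  then show ?thesis by (rule summable_LIMSEQ_zero)
qed

text \<open>Since \<open>\<lfloor>u\<rfloor> + 1 \<ge> u\<close>, the bound is at most geometric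
  with ratio \<open>r powr (1 / real n)\<close>; the remaining power of \<open>r\<close> comes from
  the \<open>- 1\<close> in the exponent.\<close>

lemma summable_of_stepwise_geometric_bound:
  fixes a :: "nat \<Rightarrow> real"
  assumes n: "1 \<le> n" and r: "0 < r" "r < 1"
    and a: "\<And>t. 0 \<le> a t" "\<And>t. a t \<le> r powi (\<lfloor>(real t - 1) / real n\<rfloor> + 1) * c" and c: "0 \<le> c"
  shows "summable a"
proof (rule summable_comparison_test)
  define s where "s = r powr (1 / real n)"
  have s: "0 < s" "s < 1" using r n powr_less_mono2[of "1 / real n" r 1] by (auto simp: s_def)
  show "summable (\<lambda>t. r powr (- (1 / real n)) * c * s ^ t)"
    using s by (intro summable_mult summable_geometric) auto
  have "a t \<le> r powr (- (1 / real n)) * c * s ^ t" for t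
  proof -
    have "r powi (\<lfloor>(real t - 1) / real n\<rfloor> + 1) = r powr (real_of_int (\<lfloor>(real t - 1) / real n\<rfloor> + 1))"
      by (rule powr_real_of_int'[symmetric]) (use r in auto)
    also have "\<dots> \<le> r powr ((real t - 1) / real n)"
      using r by (intro powr_mono') linarith+
    also have "\<dots> = r powr (- (1 / real n)) * s ^ t"
      using r s by (simp add: s_def diff_divide_distrib powr_diff powr_powr powr_minus field_simps flip: powr_realpow)
    finally show ?thesis
      using a(2)[of t] mult_right_mono[OF _ c] by (fastforce simp: mult_ac intro: order_trans)
  qed
  then show "\<exists>N. \<forall>t\<ge>N. norm (a t) \<le> r powr (- (1 / real n)) * c * s ^ t"
    using a(1) by auto
qed

section \<open>Bookkeeping of the cyclic updates\<close>

lemma iqn_index_mem: "1 \<le> n \<Longrightarrow> iqn_index n t \<in> {1..n}"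
  by (simp add: iqn_index_def Suc_leI)

lemma iqn_run_updated:
  assumes "iqn_run n f x z B" "1 \<le> n"
  defines "i \<equiv> \<lambda>t. iqn_index n t"
  shows "z (i t) (Suc t) = x (Suc t)" "z (i t) (Suc t) \<noteq> z (i t) t"
    "B (i t) (Suc t) = bfgs_update (B (i t) t) (z (i t) (Suc t) - z (i t) t)
       (grad (f (i t)) (z (i t) (Suc t)) - grad (f (i t)) (z (i t) t))"
  using assms iqn_index_mem[of n t] unfolding iqn_run_def Let_def by (auto split: if_splits)

lemma iqn_run_kept:
  assumes "iqn_run n f x z B" "i \<in> {1..n}" "i \<noteq> iqn_index n t"
  shows "z i (Suc t) = z i t" "B i (Suc t) = B i t"
  using assms unfolding iqn_run_def by (auto split: if_splits)

text \<open>Among the last \<open>n\<close> times before \<open>t\<close> one updates component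
  \<open>i\<close>, and the value set there survives until \<open>t\<close>.\<close>

lemma iqn_run_recent:
  assumes run: "iqn_run n f x z B" and n: "1 \<le> n" and t: "n \<le> t" and i: "i \<in> {1..n}"
  shows "\<exists>j<n. z i t = x (t - j)"
proof -
  obtain k where k: "k < t" "t \<le> k + n" "iqn_index n k = i"
  proof -
    define m where "m = t - n"
    define a where "a = i - 1"
    have a: "a < n" "i = Suc a" using i by (auto simp: a_def)
    \<comment> \<open>The time that updates \<open>i\<close> in the cycle containing
      \<open>m\<close>; either it or the one a cycle later lies between \<open>m\<close> and
      \<open>t - 1\<close>.\<close>
    define k where "k = n * (m div n) + a"
    have m: "m = n * (m div n) + m mod n" "m mod n < n" using n by simp_all
    have tm: "t = m + n" using t by (simp add: m_def)
    have ki: "iqn_index n k = i" "iqn_index n (k + n) = i"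
      using a by (simp_all add: iqn_index_def k_def)
    show thesis
    proof (cases "m \<le> k")
      case True
      have "k < t" "t \<le> k + n" using True m a tm unfolding k_def by linarith+
      then show thesis using ki that by blast
    next
      case False
      have "k + n < t" "t \<le> k + n + n" using False m a tm unfolding k_def by linarith+
      then show thesis using ki that by blast
    qed
  qed
  have "z i (Suc k + d) = x (Suc k)" if "d < n" for d
    using that
  proof (induction d)
    case 0
    then show ?case using iqn_run_updated(1)[OF run n, of k] k(3) by simp
  next
    case (Suc d)
    \<comment> \<open>Equal indices less than a full cycle apart would make \<open>n\<close> divide
      a positive number below \<open>n\<close>.\<close>
    have "(Suc k + d) mod n \<noteq> k mod n"
    proof
      assume "(Suc k + d) mod n = k mod n"
      then have "n dvd Suc k + d - k" by (subst (asm) mod_eq_dvd_iff_nat) auto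
      then show False using Suc.prems by (simp add: nat_dvd_not_less)
    qed
    then have "i \<noteq> iqn_index n (Suc k + d)" using k(3) by (simp add: iqn_index_def)
    then show ?case using Suc iqn_run_kept(1)[OF run i] by simp
  qed
  from this[of "t - Suc k"] have "z i t = x (t - (t - Suc k))" using k by simp
  then show ?thesis using k by (intro exI[of _ "t - Suc k"]) auto
qed

section \<open>Sums of positive definite matrices\<close>

lemma spd_sum:
  assumes "finite I" "I \<noteq> {}" "\<And>i. i \<in> I \<Longrightarrow> spd (A i)"
  shows "spd (\<Sum>i\<in>I. A i :: real^'p^'p)"
  unfolding spd_def
proof (intro conjI allI impI)
  show "transpose (\<Sum>i\<in>I. A i) = (\<Sum>i\<in>I. A i)"
  proof (rule symmetric_matrixI)
    fix u v
    have "(A i *v u) \<bullet> v = u \<bullet> (A i *v v)" if "i \<in> I" for i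
      using assms(3)[OF that] by (simp add: spd_def inner_matrix_vector_sym)
    then show "((\<Sum>i\<in>I. A i) *v u) \<bullet> v = u \<bullet> ((\<Sum>i\<in>I. A i) *v v)"
      by (simp add: sum_matrix_vector_mult inner_sum_left inner_sum_right)
  qed
  fix v :: "real^'p" assume "v \<noteq> 0"
  then show "0 < v \<bullet> ((\<Sum>i\<in>I. A i) *v v)"
    using assms by (simp add: sum_matrix_vector_mult inner_sum_right spd_def sum_pos)
qed

text \<open>Lower bounds on quadratic forms add up, lower bounds on norms do not; Cauchy-Schwarz
  returns to the norm at the end.\<close>

lemma norm_sum_matrix_vector_ge:
  fixes A :: "nat \<Rightarrow> real^'p^'p"
  assumes "\<And>i. i \<in> {1..n} \<Longrightarrow> m * (norm v)\<^sup>2 \<le> v \<bullet> (A i *v v)"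
  shows "real n * m * norm v \<le> norm ((\<Sum>i=1..n. A i) *v v)"
proof (cases "v = 0")
  case False
  have "real n * m * norm v * norm v = (\<Sum>i=1..n. m * (norm v)\<^sup>2)"
    by (simp add: power2_eq_square)
  also have "\<dots> \<le> (\<Sum>i=1..n. v \<bullet> (A i *v v))" by (intro sum_mono assms)
  also have "\<dots> = v \<bullet> ((\<Sum>i=1..n. A i) *v v)"
    by (simp add: sum_matrix_vector_mult inner_sum_right)
  also have "\<dots> \<le> norm ((\<Sum>i=1..n. A i) *v v) * norm v"
    by (metis norm_cauchy_schwarz mult.commute)
  finally show ?thesis using False by simp
qed simp

text \<open>The admissible pair is replaced by what it provides: summable errors, and common
  Frobenius bounds on the matrices and their inverses.\<close>

lemma iqn_superlinear:
  fixes f :: "nat \<Rightarrow> real^'p \<Rightarrow> real"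
    and xs :: "real^'p"
    and x :: "nat \<Rightarrow> real^'p"
    and z :: "nat \<Rightarrow> nat \<Rightarrow> real^'p"
    and B :: "nat \<Rightarrow> nat \<Rightarrow> real^'p^'p"
  assumes n: "1 \<le> n"
    and f: "\<And>i. i \<in> {1..n} \<Longrightarrow> twice_differentiable (f i)"
    and xs: "(\<Sum>i=1..n. grad (f i) xs) = 0"
    and mu: "0 < \<mu>" "\<And>i v w. i \<in> {1..n} \<Longrightarrow>
           \<mu> * (norm (v - w))\<^sup>2 \<le> (grad (f i) v - grad (f i) w) \<bullet> (v - w)"
    and L: "\<And>i v w. i \<in> {1..n} \<Longrightarrow>
           (grad (f i) v - grad (f i) w) \<bullet> (v - w) \<le> L * (norm (v - w))\<^sup>2"
    and Lt: "0 \<le> Lt"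
      "\<And>i v w. i \<in> {1..n} \<Longrightarrow> opnorm (hess (f i) v - hess (f i) w) \<le> Lt * norm (v - w)"
    and run: "iqn_run n f x z B"
    and sumx: "summable (\<lambda>t. norm (x t - xs))"
    and C: "0 < C" "\<And>i t. i \<in> {1..n} \<Longrightarrow> norm (B i t) \<le> C"
      "\<And>i t. i \<in> {1..n} \<Longrightarrow> norm (matrix_inv (B i t)) \<le> C"
  shows "(\<lambda>t. norm (x (Suc t) - xs)) \<in> o(\<lambda>t. \<Sum>j<n. norm (x (t - j) - xs))"
proof -
  define H where "H i = hess (f i) xs" for i
  define e where "e t = x t - xs" for t
  define Z where "Z i t = z i t - xs" for i t
  define W where "W t = (\<Sum>j<n. norm (e (t - j)))" for t
  \<comment> \<open>From time \<open>n\<close> on this bounds both norms whose maximum is the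
    \<sigma> of the theorem; as a sum of error norms it inherits their summability.\<close>
  define \<sigma> where "\<sigma> t = norm (e (Suc t)) + W t" for t
  define i where "i t = iqn_index n t" for t
  define s where "s t = z (i t) (Suc t) - z (i t) t" for t
  define y where "y t = grad (f (i t)) (z (i t) (Suc t)) - grad (f (i t)) (z (i t) t)" for t
  define q where "q t = norm (matrix_inv (B (i t) t) *v y t - s t) / norm (s t)" for t
  define h where "h = (\<Sum>k=1..n. norm (H k))"
  note lin = grad_linearization[OF f Lt(2) Lt(1)]
  have i: "i t \<in> {1..n}" for t unfolding i_def by (rule iqn_index_mem[OF n])
  have H_sym: "transpose (H k) = H k" if "k \<in> {1..n}" for k
    unfolding H_def by (rule hess_symmetric[OF f[OF that] Lt(2)[OF that] Lt(1)])
  have H_co: "\<mu> * (norm v)\<^sup>2 \<le> v \<bullet> (H k *v v)" if "k \<in> {1..n}" for k v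
    unfolding H_def by (rule hess_coercive[OF f[OF that] Lt(2)[OF that] Lt(1) mu(2)[OF that]])
  have H_le: "norm (H k) \<le> h" if "k \<in> {1..n}" for k
    unfolding h_def using that by (intro member_le_sum) auto
  have h0: "0 \<le> h" by (simp add: h_def sum_nonneg)
  have W_nonneg: "0 \<le> W t" for t by (simp add: W_def sum_nonneg)
  have Z_recent: "\<exists>j<n. Z k t = e (t - j)" if "n \<le> t" "k \<in> {1..n}" for k t
    using iqn_run_recent[OF run n that] by (auto simp: Z_def e_def)
  have Z_le: "norm (Z k t) \<le> W t" if t: "n \<le> t" and k: "k \<in> {1..n}" for k t
  proof -
    obtain j where "j < n" "Z k t = e (t - j)" using Z_recent[OF t k] by blast
    then show ?thesis
      unfolding W_def by (simp add: member_le_sum[of j "{..<n}" "\<lambda>j. norm (e (t - j))"])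
  qed
  have upd: "z (i t) (Suc t) = x (Suc t)" "B (i t) (Suc t) = bfgs_update (B (i t) t) (s t) (y t)"
    and s0: "s t \<noteq> 0" for t
    using iqn_run_updated[OF run n, of t] unfolding i_def s_def y_def by auto
  have s_eq: "s t = e (Suc t) - Z (i t) t" for t by (simp add: s_def upd e_def Z_def)
  have keep: "Z k (Suc t) = Z k t \<and> B k (Suc t) = B k t" if "k \<in> {1..n}" "k \<noteq> i t" for k t
    using iqn_run_kept[OF run that(1)] that(2) by (simp add: i_def Z_def)
  have ys_ge: "\<mu> * (norm (s t))\<^sup>2 \<le> y t \<bullet> s t" for t
    unfolding y_def s_def by (rule mu(2)[OF i])
  have ys_le: "y t \<bullet> s t \<le> L * (norm (s t))\<^sup>2" for t
    unfolding y_def s_def by (rule L[OF i])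
  have "0 < \<mu> * (norm (s t))\<^sup>2" for t using s0 mu(1) by simp
  then have ys_pos: "0 < y t \<bullet> s t" for t using ys_ge less_le_trans by blast
  have L_pos: "0 < L"
  proof -
    have "0 < L * (norm (s 0))\<^sup>2" using ys_pos[of 0] ys_le[of 0] by linarith
    then show ?thesis by (simp add: zero_less_mult_iff)
  qed
  have spdB: "spd (B k t)" if k: "k \<in> {1..n}" for k t
  proof (induction t)
    case 0
    then show ?case using run k by (auto simp: iqn_run_def)
  next
    case (Suc t)
    then show ?case
      using keep[OF k, of t] upd(2)[of t] bfgs_update_spd(1)[OF _ ys_pos] by (cases "k = i t") auto
  qed
  have sum_e: "summable (\<lambda>t. norm (e t))" using sumx by (simp add: e_def)
  have sum_W: "summable W"
  proof -
    \<comment> \<open>For \<open>t < j\<close> truncated subtraction repeats \<open>e 0\<close>,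
      which affects finitely many terms only.\<close>
    have "summable (\<lambda>t. norm (e (t - j)))" for j
      using sum_e summable_iff_shift[of "\<lambda>t. norm (e (t - j))" j] by simp
    then show ?thesis unfolding W_def[abs_def] by (intro summable_sum)
  qed
  have sum_\<sigma>: "summable \<sigma>"
    unfolding \<sigma>_def[abs_def] using sum_e sum_W summable_Suc_iff[of "\<lambda>t. norm (e t)"]
    by (intro summable_add) simp_all
  have \<sigma>_lim: "\<sigma> \<longlonglongrightarrow> 0" using sum_\<sigma> by (rule summable_LIMSEQ_zero)
  have \<sigma>_nonneg: "0 \<le> \<sigma> t" for t using W_nonneg by (simp add: \<sigma>_def)
  have y_near: "norm (y t - H (i t) *v s t) \<le> Lt * \<sigma> t * norm (s t)" if t: "n \<le> t" for t
    unfolding y_def s_def H_def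
  proof (rule lin[OF i i])
    show "norm (z (i t) (Suc t) - xs) \<le> \<sigma> t" using W_nonneg by (simp add: upd \<sigma>_def e_def)
    show "norm (z (i t) t - xs) \<le> \<sigma> t"
      using Z_le[OF t i, of t] by (simp add: Z_def \<sigma>_def add_increasing)
  qed
  \<comment> \<open>From \<open>T\<close> on the secant perturbation \<open>Lt * \<sigma> t\<close>
    is small enough for the potential estimate.\<close>
  obtain T where T: "n \<le> T" "\<And>t. T \<le> t \<Longrightarrow> 6 * (Lt * \<sigma> t) \<le> \<mu>"
  proof -
    have "(\<lambda>t. 6 * (Lt * \<sigma> t)) \<longlonglongrightarrow> 0" using \<sigma>_lim by (auto intro!: tendsto_eq_intros)
    then have "\<forall>\<^sub>F t in sequentially. 6 * (Lt * \<sigma> t) < \<mu>" using mu(1) by (rule order_tendstoD)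
    then obtain T where "\<And>t. T \<le> t \<Longrightarrow> 6 * (Lt * \<sigma> t) < \<mu>" by (auto simp: eventually_sequentially)
    then show thesis by (intro that[of "max n T"]) (auto intro: less_imp_le)
  qed
  have q_lim: "q \<longlonglongrightarrow> 0"
  proof -
    \<comment> \<open>One potential for all components together, as the updated index changes with
      \<open>t\<close>.\<close>
    define V where "V t = (\<Sum>k=1..n. bfgs_potential (H k) (matrix_inv (B k t)))" for t
    define M where "M = 6 * (C\<^sup>2 * (2 * h + \<mu>) + 2 * C)"
    have M0: "0 \<le> M" using C(1) h0 mu(1) by (simp add: M_def)
    have "(\<lambda>t. \<mu> / (2 * L) * (q t)\<^sup>2) \<longlonglongrightarrow> 0"
    proof (rule tendsto_0_of_summable_decrease)
      fix t assume t: "T \<le> t"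
      have "V (Suc t) - V t = bfgs_potential (H (i t)) (matrix_inv (B (i t) (Suc t)))
          - bfgs_potential (H (i t)) (matrix_inv (B (i t) t))"
        unfolding V_def by (rule sum_diff_single) (use i keep in auto)
      also have "\<dots> \<le> - (\<mu> / (2 * L) * (q t)\<^sup>2)
          + 6 * (C\<^sup>2 * (2 * norm (H (i t)) + \<mu>) + 2 * C) * (Lt * \<sigma> t)"
        using bfgs_step_potential[where C = C and \<eta> = "Lt * \<sigma> t", OF H_sym[OF i[of t]]
            H_co[OF i[of t]] mu(1) spdB[OF i[of t], of t] ys_pos[of t] ys_le[of t]]
          C(3)[OF i[of t], of t] C(3)[OF i[of t], of "Suc t"] y_near[of t] T t
        by (simp add: upd q_def)
      also have "\<dots> \<le> - (\<mu> / (2 * L) * (q t)\<^sup>2) + M * (Lt * \<sigma> t)"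
        unfolding M_def
        by (intro add_left_mono mult_right_mono mult_left_mono add_mono H_le[OF i])
          (use C(1) Lt(1) \<sigma>_nonneg in auto)
      finally show "V (Suc t) \<le> V t - \<mu> / (2 * L) * (q t)\<^sup>2 + M * (Lt * \<sigma> t)" by simp
    next
      fix t
      \<comment> \<open>The zero weight has potential zero, so comparing weights gives a lower bound
        for \<open>V\<close>.\<close>
      have zero: "bfgs_potential 0 K = 0" for K :: "real^'p^'p"
        by (simp add: bfgs_potential_def matrix_matrix_mult_def zero_vec_def[symmetric])
      show "- (\<Sum>k=1..n. norm (0 - H k) * (C\<^sup>2 * (norm (0::real^'p^'p) + norm (H k)) + 2 * C)) \<le> V t"
        unfolding V_def sum_negf[symmetric]
      proof (rule sum_mono)
        fix k assume k: "k \<in> {1..n}"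
        show "- (norm (0 - H k) * (C\<^sup>2 * (norm (0::real^'p^'p) + norm (H k)) + 2 * C))
            \<le> bfgs_potential (H k) (matrix_inv (B k t))"
          using abs_bfgs_potential_diff_le[OF C(3)[OF k, of t], of 0 "H k"] by (simp add: zero)
      qed
    qed (use mu(1) L_pos M0 Lt(1) \<sigma>_nonneg sum_\<sigma> in \<open>auto intro: summable_mult\<close>)
    then have "(\<lambda>t. (2 * L / \<mu>) * (\<mu> / (2 * L) * (q t)\<^sup>2)) \<longlonglongrightarrow> 0"
      by (rule tendsto_mult_right_zero)
    then have "(\<lambda>t. (q t)\<^sup>2) \<longlonglongrightarrow> 0" using mu(1) L_pos by simp
    from tendsto_real_sqrt[OF this] show ?thesis by (simp add: tendsto_rabs_zero_iff)
  qed
  have secant: "norm ((B (i t) t - H (i t)) *v s t) \<le> (C * q t + Lt * \<sigma> t) * norm (s t)"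
    if t: "n \<le> t" for t
  proof -
    let ?w = "matrix_inv (B (i t) t) *v y t - s t"
    \<comment> \<open>\<open>B\<close> maps the secant residual of its inverse to the secant
      residual of \<open>B\<close> itself.\<close>
    have "B (i t) t *v ?w = y t - B (i t) t *v s t"
      by (simp add: matrix_vector_mult_diff_distrib matrix_inv_vec(1)[OF spd_invertible[OF spdB[OF i]]])
    then have "(B (i t) t - H (i t)) *v s t = (y t - H (i t) *v s t) - B (i t) t *v ?w"
      by (simp add: matrix_vector_mult_diff_rdistrib)
    then have "norm ((B (i t) t - H (i t)) *v s t)
        \<le> norm (y t - H (i t) *v s t) + norm (B (i t) t *v ?w)"
      by (simp add: norm_triangle_ineq4)
    also have "norm (B (i t) t *v ?w) \<le> C * norm ?w"
      by (intro order_trans[OF norm_matrix_vector_mult_le] mult_right_mono C(2) i) simp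
    also have "C * norm ?w = C * q t * norm (s t)" using s0 by (simp add: q_def)
    finally show ?thesis using y_near[OF t] by (simp add: algebra_simps)
  qed
  have drift: "(\<lambda>t. norm (B (i t) (Suc t) - B (i t) t)) \<longlonglongrightarrow> 0"
  proof (rule Lim_null_comparison)
    \<comment> \<open>The constant of the update estimate for curvature at least
      \<open>\<mu>\<close> and \<open>y\<close> of norm at most \<open>h + \<mu>\<close> times that
      of \<open>s\<close>; the outer factors \<open>C\<close> pass from the inverses back to the
      matrices.\<close>
    define m where "m = 2 / \<mu> + (h + \<mu>) / \<mu>\<^sup>2"
    show "(\<lambda>t. C * (m * q t) * C) \<longlonglongrightarrow> 0" using q_lim by (auto intro!: tendsto_eq_intros)
    show "\<forall>\<^sub>F t in sequentially. norm (norm (B (i t) (Suc t) - B (i t) t)) \<le> C * (m * q t) * C"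
    proof (rule eventually_mono[OF eventually_ge_at_top[of T]])
      fix t assume t: "T \<le> t"
      have "norm (y t) \<le> norm (H (i t) *v s t) + norm (y t - H (i t) *v s t)"
        using norm_triangle_ineq[of "H (i t) *v s t" "y t - H (i t) *v s t"] by simp
      also have "\<dots> \<le> h * norm (s t) + \<mu> * norm (s t)"
      proof (rule add_mono)
        show "norm (H (i t) *v s t) \<le> h * norm (s t)"
          by (intro order_trans[OF norm_matrix_vector_mult_le] mult_right_mono H_le i) simp
        have "Lt * \<sigma> t \<le> \<mu>" using T(2)[OF t] Lt(1) \<sigma>_nonneg[of t] by (smt (verit) mult_nonneg_nonneg)
        then have "Lt * \<sigma> t * norm (s t) \<le> \<mu> * norm (s t)" by (rule mult_right_mono) simp
        then show "norm (y t - H (i t) *v s t) \<le> \<mu> * norm (s t)" using y_near[of t] T(1) t by linarith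
      qed
      finally have y_le: "norm (y t) \<le> (h + \<mu>) * norm (s t)" by (simp add: algebra_simps)
      let ?B = "B (i t) t" and ?B' = "B (i t) (Suc t)"
      have K_diff: "norm (matrix_inv ?B' - matrix_inv ?B) \<le> m * q t"
        unfolding upd bfgs_update_spd(2)[OF spdB[OF i] ys_pos] m_def q_def
        by (rule norm_inv_bfgs_diff_le[OF s0 mu(1) ys_ge y_le])
      have "norm (?B' - ?B) \<le> norm ?B' * norm (matrix_inv ?B' - matrix_inv ?B) * norm ?B"
        by (intro norm_diff_le_matrix_inv_diff spd_invertible spdB i)
      also have "\<dots> \<le> C * (m * q t) * C"
        using order_trans[OF norm_ge_zero K_diff] C(1)
        by (intro mult_mono C(2) i K_diff) auto
      finally show "norm (norm (?B' - ?B)) \<le> C * (m * q t) * C" by simp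
    qed
  qed
  have "(\<lambda>t. norm (e (Suc t))) \<in> o(\<lambda>t. \<Sum>j<n. norm (e (t - j)))"
  proof (rule incremental_superlinear[where idx = i and Z = Z and B = B and H = H and n = n and C = C
        and c = "real n * (1 / C)" and d = "real n * \<mu>" and \<kappa> = "\<lambda>t. C * q t + Lt * \<sigma> t"])
    \<comment> \<open>The two constants sum, over \<open>n\<close> components, the coercivity
      constants \<open>1 / C\<close> of the matrices and \<open>\<mu>\<close> of the
      Hessians.\<close>
    show "0 < real n * (1 / C)" "0 < real n * \<mu>" using n C(1) mu(1) by auto
    show "real n * (1 / C) * norm v \<le> norm ((\<Sum>k=1..n. B k t) *v v)" for t v
    proof (rule norm_sum_matrix_vector_ge)
      fix k assume k: "k \<in> {1..n}"
      show "1 / C * (norm v)\<^sup>2 \<le> v \<bullet> (B k t *v v)"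
        using spd_coercive[OF spdB[OF k] C(3)[OF k], of v t] C(1) by (simp add: field_simps)
    qed
    show "real n * \<mu> * norm v \<le> norm ((\<Sum>k=1..n. H k) *v v)" for v
      by (intro norm_sum_matrix_vector_ge H_co)
    show "(\<lambda>t. C * q t + Lt * \<sigma> t) \<longlonglongrightarrow> 0"
      using q_lim \<sigma>_lim by (auto intro!: tendsto_eq_intros)
    show "\<forall>\<^sub>F t in sequentially. norm ((B (i t) t - H (i t)) *v (e (Suc t) - Z (i t) t))
        \<le> (C * q t + Lt * \<sigma> t) * norm (e (Suc t) - Z (i t) t)"
      using secant unfolding s_eq eventually_sequentially by blast
    show "(\<lambda>t. norm ((\<Sum>k=1..n. B k t) *v e (Suc t) - (\<Sum>k=1..n. (B k t - H k) *v Z k t)))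
        \<in> o(\<lambda>t. \<Sum>j<n. norm (e (t - j)))"
      unfolding W_def[symmetric]
    proof (rule norm_smallo_bound)
      \<comment> \<open>The linearization error is quadratic in \<open>W\<close>, and
        \<open>W\<close> tends to 0.\<close>
      have "W \<in> o(\<lambda>_. 1)" by (rule smalloI_tendsto) (use sum_W summable_LIMSEQ_zero in auto)
      from landau_o.small_big_mult[OF this landau_o.big_refl[of W]]
      show "(\<lambda>t. real n * Lt * (W t * W t)) \<in> o(\<lambda>t. W t)" by simp
      show "\<forall>\<^sub>F t in sequentially. norm ((\<Sum>k=1..n. B k t) *v e (Suc t)
          - (\<Sum>k=1..n. (B k t - H k) *v Z k t)) \<le> real n * Lt * (W t * W t)"
      proof (rule eventually_mono[OF eventually_ge_at_top[of n]])
        fix t assume t: "n \<le> t"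
        let ?S = "\<Sum>k=1..n. B k t" and ?g = "\<lambda>k. grad (f k) (z k t)"
        let ?r = "\<lambda>k. grad (f k) (z k t) - grad (f k) xs - H k *v (z k t - xs)"
        have S: "spd ?S" using n by (intro spd_sum spdB) auto
        have "spd ((1 / real n) *\<^sub>R ?S)"
          using S n by (simp add: spd_def transpose_scalar flip: scaleR_matrix_vector_assoc)
        note inv = matrix_inv_vec(1)[OF spd_invertible[OF this]]
        have "x (Suc t) = matrix_inv ((1 / real n) *\<^sub>R ?S) *v
          ((1 / real n) *\<^sub>R (\<Sum>k=1..n. B k t *v z k t) - (1 / real n) *\<^sub>R (\<Sum>k=1..n. ?g k))"
          using run unfolding iqn_run_def by blast
        then have "((1 / real n) *\<^sub>R ?S) *v x (Suc t)
          = (1 / real n) *\<^sub>R (\<Sum>k=1..n. B k t *v z k t) - (1 / real n) *\<^sub>R (\<Sum>k=1..n. ?g k)"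
          by (simp only: inv)
        then have "(1 / real n) *\<^sub>R (?S *v x (Suc t))
          = (1 / real n) *\<^sub>R ((\<Sum>k=1..n. B k t *v z k t) - (\<Sum>k=1..n. ?g k))"
          by (simp add: scaleR_diff_right flip: scaleR_matrix_vector_assoc)
        then have "?S *v x (Suc t) = (\<Sum>k=1..n. B k t *v z k t) - (\<Sum>k=1..n. ?g k)"
          using n by simp
        \<comment> \<open>The gradients at \<open>xs\<close> sum to 0, so subtracting them is free
          and leaves the remainders \<open>?r\<close>.\<close>
        then have "?S *v e (Suc t) - (\<Sum>k=1..n. (B k t - H k) *v Z k t) = - (\<Sum>k=1..n. ?r k)"
          using xs by (simp add: e_def Z_def matrix_vector_mult_diff_distrib
              matrix_vector_mult_diff_rdistrib sum_matrix_vector_mult sum_subtractf)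
        then have "norm (?S *v e (Suc t) - (\<Sum>k=1..n. (B k t - H k) *v Z k t)) = norm (\<Sum>k=1..n. ?r k)"
          by simp
        also have "\<dots> \<le> (\<Sum>k=1..n. norm (?r k))" by (rule norm_sum)
        also have "\<dots> \<le> (\<Sum>k=1..n. Lt * (W t * W t))"
        proof (rule sum_mono)
          fix k assume k: "k \<in> {1..n}"
          have zW: "norm (z k t - xs) \<le> W t" using Z_le[OF t k] by (simp add: Z_def)
          have "norm (?r k) \<le> Lt * W t * norm (z k t - xs)"
            unfolding H_def by (rule lin[OF k k]) (use zW W_nonneg in auto)
          also have "\<dots> \<le> Lt * W t * W t"
            using zW W_nonneg Lt(1) by (intro mult_left_mono) auto
          finally show "norm (?r k) \<le> Lt * (W t * W t)" by (simp add: mult.assoc)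
        qed
        finally show "norm (?S *v e (Suc t) - (\<Sum>k=1..n. (B k t - H k) *v Z k t))
          \<le> real n * Lt * (W t * W t)" by simp
      qed
    qed
  qed (use i Z_recent keep C(2) drift upd in \<open>auto simp: Z_def e_def\<close>)
  then show ?thesis by (simp add: e_def)
qed

theorem theorem4p6:
  fixes f :: "nat \<Rightarrow> real^'p \<Rightarrow> real"
    and xs :: "real^'p"
    and x :: "nat \<Rightarrow> real^'p"
    and z :: "nat \<Rightarrow> nat \<Rightarrow> real^'p"
    and B :: "nat \<Rightarrow> nat \<Rightarrow> real^'p^'p"
    and n :: nat
    and \<mu> L Lt r \<epsilon> \<delta> :: real
  assumes "1 \<le> n"
    and "\<forall>i\<in>{1..n}. twice_differentiable (f i)"
    and "unique_minimizer (\<lambda>w. (1 / real n) * (\<Sum>i=1..n. f i w)) xs"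
    and "0 < \<mu>" and "\<mu> \<le> L"
    and "\<forall>i\<in>{1..n}. \<forall>v w.
           \<mu> * (norm (v - w))\<^sup>2 \<le> (grad (f i) v - grad (f i) w) \<bullet> (v - w) \<and>
           (grad (f i) v - grad (f i) w) \<bullet> (v - w) \<le> L * (norm (v - w))\<^sup>2"
    and "0 < Lt"
    and "\<forall>i\<in>{1..n}. \<forall>v w. opnorm (hess (f i) v - hess (f i) w) \<le> Lt * norm (v - w)"
    and "0 < r" and "r < 1"
    and "admissible_pair n f xs r \<epsilon> \<delta>"
    and "iqn_run n f x z B"
    and "iqn_close_start n f xs \<epsilon> \<delta> (x 0) (\<lambda>i. B i 0)"
    and "\<forall>t. let i = iqn_index n t in
           max (norm (z i (Suc t) - xs)) (norm (z i t - xs)) < \<mu> / (3 * Lt)"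
  shows "(\<lambda>t. norm (x t - xs) / ((1 / real n) * (\<Sum>j=1..n. norm (x (t - j) - xs))))
           \<longlonglongrightarrow> 0"
proof -
  note n = \<open>1 \<le> n\<close>
  have adm: "\<And>t. norm (x t - xs) \<le> r powi (\<lfloor>(real t - 1) / real n\<rfloor> + 1) * norm (x 0 - xs)"
    "\<exists>C. \<forall>i\<in>{1..n}. \<forall>t. opnorm (B i t) \<le> C \<and> opnorm (matrix_inv (B i t)) \<le> C"
    using assms(11-13) unfolding admissible_pair_def by blast+
  obtain C where C: "\<And>i t. i \<in> {1..n} \<Longrightarrow> opnorm (B i t) \<le> C \<and> opnorm (matrix_inv (B i t)) \<le> C"
    using adm(2) by blast
  \<comment> \<open>The absolute value and the added 1 make the Frobenius bound positive whatever
    \<open>C\<close> is.\<close>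
  define D where "D = (real CARD('p))\<^sup>2 * \<bar>C\<bar> + 1"
  have D: "norm A \<le> D" if "opnorm A \<le> C" for A :: "real^'p^'p"
  proof -
    have "norm A \<le> (real CARD('p))\<^sup>2 * opnorm A" by (rule norm_le_opnorm)
    also have "\<dots> \<le> (real CARD('p))\<^sup>2 * \<bar>C\<bar>" using that by (intro mult_left_mono) auto
    finally show ?thesis by (simp add: D_def)
  qed
  have "D > 0" by (simp add: D_def add_nonneg_pos)
  have min: "(1 / real n) * (\<Sum>i=1..n. f i xs) \<le> (1 / real n) * (\<Sum>i=1..n. f i w)" for w
    using assms(3) unfolding unique_minimizer_def is_arg_min_def by (auto simp: not_less)
  have "(\<Sum>i=1..n. grad (f i) xs) = 0"
    by (rule sum_grad_eq_0_at_minimizer[where c = "1 / real n" and f = f and I = "{1..n}" and p = xs, OF _ _ min])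
      (use assms(2) n in \<open>auto simp: twice_differentiable_def\<close>)
  moreover have "summable (\<lambda>t. norm (x t - xs))"
    by (rule summable_of_stepwise_geometric_bound[OF n assms(9,10) _ adm(1)]) auto
  ultimately have "(\<lambda>t. norm (x (Suc t) - xs)) \<in> o(\<lambda>t. \<Sum>j<n. norm (x (t - j) - xs))"
    using assms \<open>D > 0\<close> C D by (intro iqn_superlinear[where \<mu> = \<mu> and L = L and Lt = Lt and C = D and B = B and z = z and f = f]) auto
  \<comment> \<open>Where the window of errors vanishes, the quotient is 0 by the convention on
    division.\<close>
  from tendsto_mult_right_zero[OF smalloD_tendsto[OF this], of "real n"]
  have "(\<lambda>t. norm (x (Suc t) - xs) / ((1 / real n) * (\<Sum>j<n. norm (x (t - j) - xs)))) \<longlonglongrightarrow> 0"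
    by (simp add: mult.commute)
  then have "(\<lambda>t. norm (x (Suc t) - xs) / ((1 / real n) * (\<Sum>j=1..n. norm (x (Suc t - j) - xs)))) \<longlonglongrightarrow> 0"
    by (simp add: sum.atLeast1_atMost_eq)
  then show ?thesis by (rule LIMSEQ_imp_Suc)
qed

end
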